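(* Deciding whether a SAT instance (a Boolean formula in conjunctive normal form) is satisfiable can be reduced to finding the true proof number of the root of a directed acyclic AND/OR graph. Likewise, it can be reduced to finding the true disproof number of the root of a directed acyclic AND/OR graph.
   Context: A directed acyclic AND/OR graph is a finite directed acyclic graph $G=\langle V_o,V_a,E\rangle$ whose nodes are partitioned into OR nodes $V_o$ and AND nodes $V_a$. Nodes with no outgoing edges are leaves. A leaf is either terminal, with a known status (solvable or unsolvable), or non-terminal, with unknown status. Solvability propagates upward as follows. An OR node is solvable iff at least one of its children is solvable, and it is unsolvable iff all of its children are unsolvable. An AND node is solvable iff all of its children are solvable, and it is unsolvable iff at least one child is unsolvable. The true proof number $p(x)$ of a node $x$ is the minimum number of non-terminal leaf descendants of $x$ that must be solved (shown solvable) in order to prove that $x$ is solvable. Equivalently, it is the minimum cardinality of a set $S$ of non-terminal leaves such that, if every leaf in $S$ is solvable, then $x$ is solvable. It is $0$ if $x$ is already solvable, and $\infty$ if no such $S$ exists. The true disproof number $d(x)$ is defined dually. It is the minimum number of non-terminal leaf descendants that must be shown unsolvable in order to show that $x$ is unsolvable. These true values count each leaf once, even when the leaf is reachable along several paths. They therefore generally differ from the tree-recursive values (min/sum rules) in a DAG. *)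

theory Defs
  imports "HOL-Library.Extended_Nat" "HOL-Computational_Algebra.Polynomial"
begin

section \<open>AND/OR graphs and true proof and disproof numbers\<close>

text \<open>The fields \<open>solved\<close> and \<open>unsolved\<close> hold the terminal leaves of known status.\<close>

record 'v and_or_graph =
  or_nodes :: "'v set"
  and_nodes :: "'v set"
  edges :: "('v \<times> 'v) set"
  solved :: "'v set"
  unsolved :: "'v set"

definition nodes :: "'v and_or_graph \<Rightarrow> 'v set" where
  "nodes G = or_nodes G \<union> and_nodes G"

definition children :: "'v and_or_graph \<Rightarrow> 'v \<Rightarrow> 'v set" where
  "children G x = {y. (x, y) \<in> edges G}"

definition leaves :: "'v and_or_graph \<Rightarrow> 'v set" where
  "leaves G = {x \<in> nodes G. children G x = {}}"

definition nonterminal_leaves :: "'v and_or_graph \<Rightarrow> 'v set" where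
  "nonterminal_leaves G = leaves G - (solved G \<union> unsolved G)"

definition and_or_dag :: "'v and_or_graph \<Rightarrow> bool" where
  "and_or_dag G \<longleftrightarrow>
     finite (nodes G) \<and> or_nodes G \<inter> and_nodes G = {} \<and>
     edges G \<subseteq> nodes G \<times> nodes G \<and> acyclic (edges G) \<and>
     solved G \<subseteq> leaves G \<and> unsolved G \<subseteq> leaves G \<and> solved G \<inter> unsolved G = {}"

definition is_root :: "'v and_or_graph \<Rightarrow> 'v \<Rightarrow> bool" where
  "is_root G r \<longleftrightarrow> r \<in> nodes G \<and> (\<forall>x \<in> nodes G. (r, x) \<in> (edges G)\<^sup>*)"

text \<open>
  The propagation rules apply to inner nodes only: a leaf, although it is formally an OR or an AND
  node, gets its status from \<open>solved\<close> and \<open>unsolved\<close> and never from a vacuous quantification over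
  its children. A node may be neither solvable nor unsolvable.
\<close>

inductive solvable :: "'v and_or_graph \<Rightarrow> 'v \<Rightarrow> bool" for G where
  leaf: "x \<in> solved G \<Longrightarrow> solvable G x"
| or_node: "x \<in> or_nodes G \<Longrightarrow> y \<in> children G x \<Longrightarrow> solvable G y \<Longrightarrow> solvable G x"
| and_node: "x \<in> and_nodes G \<Longrightarrow> children G x \<noteq> {} \<Longrightarrow> (\<And>y. y \<in> children G x \<Longrightarrow> solvable G y) \<Longrightarrow>
    solvable G x"

inductive unsolvable :: "'v and_or_graph \<Rightarrow> 'v \<Rightarrow> bool" for G where
  leaf: "x \<in> unsolved G \<Longrightarrow> unsolvable G x"
| or_node: "x \<in> or_nodes G \<Longrightarrow> children G x \<noteq> {} \<Longrightarrow> (\<And>y. y \<in> children G x \<Longrightarrow> unsolvable G y) \<Longrightarrow>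
    unsolvable G x"
| and_node: "x \<in> and_nodes G \<Longrightarrow> y \<in> children G x \<Longrightarrow> unsolvable G y \<Longrightarrow> unsolvable G x"

text \<open>
  In \<^typ>\<open>enat\<close> the infimum of the empty set is \<open>\<infinity>\<close>. Each leaf counts once, however many paths
  lead to it, because \<open>S\<close> is a set.
\<close>

definition proof_number :: "'v and_or_graph \<Rightarrow> 'v \<Rightarrow> enat" where
  "proof_number G x =
     (INF S \<in> {S. S \<subseteq> nonterminal_leaves G \<and> solvable (G\<lparr>solved := solved G \<union> S\<rparr>) x}.
        enat (card S))"

definition disproof_number :: "'v and_or_graph \<Rightarrow> 'v \<Rightarrow> enat" where
  "disproof_number G x =
     (INF S \<in> {S. S \<subseteq> nonterminal_leaves G \<and> unsolvable (G\<lparr>unsolved := unsolved G \<union> S\<rparr>) x}.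
        enat (card S))"

lemma proof_number_solvable: "solvable G x \<Longrightarrow> proof_number G x = 0"
proof -
  assume "solvable G x"
  then have "proof_number G x \<le> enat (card ({} :: 'a set))"
    unfolding proof_number_def by (intro INF_lower) simp
  then show ?thesis by (simp add: enat_0)
qed

lemma disproof_number_unsolvable: "unsolvable G x \<Longrightarrow> disproof_number G x = 0"
proof -
  assume "unsolvable G x"
  then have "disproof_number G x \<le> enat (card ({} :: 'a set))"
    unfolding disproof_number_def by (intro INF_lower) simp
  then show ?thesis by (simp add: enat_0)
qed

lemma solvable_or_node_iff:
  assumes "and_or_dag G" "x \<in> or_nodes G" "x \<notin> leaves G"
  shows "solvable G x \<longleftrightarrow> (\<exists>y \<in> children G x. solvable G y)"
proof -
  have "x \<notin> solved G" "x \<notin> and_nodes G"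
    using assms by (auto simp: and_or_dag_def)
  with assms(2) show ?thesis by (subst solvable.simps) blast
qed

lemma solvable_and_node_iff:
  assumes "and_or_dag G" "x \<in> and_nodes G" "x \<notin> leaves G"
  shows "solvable G x \<longleftrightarrow> (\<forall>y \<in> children G x. solvable G y)"
proof -
  have "children G x \<noteq> {}" "x \<notin> solved G" "x \<notin> or_nodes G"
    using assms by (auto simp: and_or_dag_def leaves_def nodes_def)
  with assms(2) show ?thesis by (subst solvable.simps) blast
qed

lemma unsolvable_or_node_iff:
  assumes "and_or_dag G" "x \<in> or_nodes G" "x \<notin> leaves G"
  shows "unsolvable G x \<longleftrightarrow> (\<forall>y \<in> children G x. unsolvable G y)"
proof -
  have "children G x \<noteq> {}" "x \<notin> unsolved G" "x \<notin> and_nodes G"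
    using assms by (auto simp: and_or_dag_def leaves_def nodes_def)
  with assms(2) show ?thesis by (subst unsolvable.simps) blast
qed

lemma unsolvable_and_node_iff:
  assumes "and_or_dag G" "x \<in> and_nodes G" "x \<notin> leaves G"
  shows "unsolvable G x \<longleftrightarrow> (\<exists>y \<in> children G x. unsolvable G y)"
proof -
  have "x \<notin> unsolved G" "x \<notin> or_nodes G"
    using assms by (auto simp: and_or_dag_def)
  with assms(2) show ?thesis by (subst unsolvable.simps) blast
qed


section \<open>SAT\<close>

text \<open>
  Variables are named by bit strings. The literal \<open>(True, v)\<close> is the variable \<open>v\<close> and
  \<open>(False, v)\<close> is its negation.
\<close>

type_synonym name = "bool list"
type_synonym literal = "bool \<times> name"
type_synonym cnf = "literal list list"

definition satisfiable :: "cnf \<Rightarrow> bool" where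
  "satisfiable \<phi> \<longleftrightarrow> (\<exists>\<alpha> :: name \<Rightarrow> bool. \<forall>c \<in> set \<phi>. \<exists>(s, v) \<in> set c. \<alpha> v = s)"


section \<open>Polynomial-time computable functions\<close>

text \<open>
  Deterministic multi-tape Turing machines with two-way infinite tapes. The tape alphabet consists
  of the four symbols below and the blank \<^term>\<open>None\<close>; restricting to one fixed finite alphabet does
  not affect which functions are polynomial-time computable. The states are \<open>0, \<dots>, num_states M\<close>;
  the state \<open>0\<close> is initial and the state \<open>num_states M\<close> is halting.
\<close>

datatype sym = Bit bool | Open | Close

datatype move = MoveLeft | Stay | MoveRight

type_synonym tape = "(int \<Rightarrow> sym option) \<times> int"
type_synonym config = "nat \<times> tape list"

record tm =
  num_tapes :: nat
  num_states :: nat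
  trans :: "nat \<Rightarrow> sym option list \<Rightarrow> nat \<times> (sym option \<times> move) list"

definition wf_tm :: "tm \<Rightarrow> bool" where
  "wf_tm M \<longleftrightarrow> num_tapes M > 0 \<and>
     (\<forall>q < num_states M. \<forall>xs. length xs = num_tapes M \<longrightarrow>
        fst (trans M q xs) \<le> num_states M \<and> length (snd (trans M q xs)) = num_tapes M)"

fun shift :: "move \<Rightarrow> int" where
  "shift MoveLeft = - 1"
| "shift Stay = 0"
| "shift MoveRight = 1"

definition read_tape :: "tape \<Rightarrow> sym option" where
  "read_tape t = fst t (snd t)"

definition act_tape :: "sym option \<times> move \<Rightarrow> tape \<Rightarrow> tape" where
  "act_tape a t = ((fst t)(snd t := fst a), snd t + shift (snd a))"

definition step :: "tm \<Rightarrow> config \<Rightarrow> config" where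
  "step M c =
     (let (q, ts) = c in
      if q < num_states M
      then let (q', as) = trans M q (map read_tape ts) in (q', map2 act_tape as ts)
      else c)"

definition word_cells :: "sym list \<Rightarrow> int \<Rightarrow> sym option" where
  "word_cells w i = (if 0 \<le> i \<and> nat i < length w then Some (w ! nat i) else None)"

definition init_config :: "tm \<Rightarrow> sym list \<Rightarrow> config" where
  "init_config M w =
     (0, (word_cells w, 0) # replicate (num_tapes M - 1) (word_cells [], 0))"

text \<open>
  The input is on the first tape and the output on the last one. A halted machine idles, so
  \<open>computes_in M w t w'\<close> says that \<open>M\<close> halts on \<open>w\<close> after at most \<open>t\<close> steps with output \<open>w'\<close>.
\<close>

definition computes_in :: "tm \<Rightarrow> sym list \<Rightarrow> nat \<Rightarrow> sym list \<Rightarrow> bool" where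
  "computes_in M w t w' \<longleftrightarrow>
     (let (q, ts) = (step M ^^ t) (init_config M w) in
      q = num_states M \<and> fst (last ts) = word_cells w')"

definition poly_time :: "('a \<Rightarrow> sym list) \<Rightarrow> ('b \<Rightarrow> sym list) \<Rightarrow> ('a \<Rightarrow> 'b) \<Rightarrow> bool" where
  "poly_time enc\<^sub>1 enc\<^sub>2 f \<longleftrightarrow>
     (\<exists>M (p :: nat poly). wf_tm M \<and>
        (\<forall>x. computes_in M (enc\<^sub>1 x) (poly p (length (enc\<^sub>1 x))) (enc\<^sub>2 (f x))))"


section \<open>Encodings\<close>

definition enc_bool :: "bool \<Rightarrow> sym list" where
  "enc_bool b = [Bit b]"

definition enc_list :: "('a \<Rightarrow> sym list) \<Rightarrow> 'a list \<Rightarrow> sym list" where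
  "enc_list e xs = [Open] @ concat (map e xs) @ [Close]"

definition enc_prod :: "('a \<Rightarrow> sym list) \<Rightarrow> ('b \<Rightarrow> sym list) \<Rightarrow> 'a \<times> 'b \<Rightarrow> sym list" where
  "enc_prod e\<^sub>1 e\<^sub>2 p = [Open] @ e\<^sub>1 (fst p) @ e\<^sub>2 (snd p) @ [Close]"

text \<open>Natural numbers are encoded in unary.\<close>

definition enc_nat :: "nat \<Rightarrow> sym list" where
  "enc_nat n = enc_list enc_bool (replicate n True)"

abbreviation enc_name :: "name \<Rightarrow> sym list" where
  "enc_name \<equiv> enc_list enc_bool"

definition enc_cnf :: "cnf \<Rightarrow> sym list" where
  "enc_cnf = enc_list (enc_list (enc_prod enc_bool enc_name))"

text \<open>
  A rooted AND/OR graph whose nodes are named by bit strings is given to a machine by listing, in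
  this order and possibly with repetitions, its OR nodes, AND nodes, edges, solved leaves and
  unsolved leaves, followed by its root.
\<close>

type_synonym graph_listing =
  "name list \<times> name list \<times> (name \<times> name) list \<times> name list \<times> name list \<times> name"

fun graph_of :: "graph_listing \<Rightarrow> name and_or_graph" where
  "graph_of (os, as, es, ss, us, r) =
     \<lparr>or_nodes = set os, and_nodes = set as, edges = set es, solved = set ss, unsolved = set us\<rparr>"

fun root_of :: "graph_listing \<Rightarrow> name" where
  "root_of (os, as, es, ss, us, r) = r"

definition enc_graph :: "graph_listing \<Rightarrow> sym list" where
  "enc_graph =
     enc_prod (enc_list enc_name) (enc_prod (enc_list enc_name)
       (enc_prod (enc_list (enc_prod enc_name enc_name))
         (enc_prod (enc_list enc_name) (enc_prod (enc_list enc_name) enc_name))))"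

text \<open>The encodings are self-delimiting, hence injective.\<close>

definition self_delimiting :: "('a \<Rightarrow> sym list) \<Rightarrow> bool" where
  "self_delimiting e \<longleftrightarrow>
     (\<forall>x y u v. e x @ u = e y @ v \<longrightarrow> x = y \<and> u = v) \<and> (\<forall>x. e x \<noteq> [] \<and> hd (e x) \<noteq> Close)"

lemma self_delimitingI:
  assumes "\<And>x y u v. e x @ u = e y @ v \<Longrightarrow> x = y \<and> u = v"
    and "\<And>x. e x \<noteq> [] \<and> hd (e x) \<noteq> Close"
  shows "self_delimiting e"
  using assms unfolding self_delimiting_def by blast

lemma self_delimitingD:
  assumes "self_delimiting e" "e x @ u = e y @ v"
  shows "x = y" "u = v"
  using assms unfolding self_delimiting_def by blast+

lemma self_delimiting_imp_inj:
  assumes "self_delimiting e"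
  shows "inj e"
proof (rule injI)
  fix x y assume "e x = e y"
  then have "e x @ [] = e y @ []" by simp
  with assms show "x = y" by (rule self_delimitingD)
qed

lemma self_delimiting_bool: "self_delimiting enc_bool"
  by (auto simp: self_delimiting_def enc_bool_def)

lemma self_delimiting_prod:
  assumes "self_delimiting e\<^sub>1" "self_delimiting e\<^sub>2"
  shows "self_delimiting (enc_prod e\<^sub>1 e\<^sub>2)"
proof (rule self_delimitingI)
  fix p q u v assume "enc_prod e\<^sub>1 e\<^sub>2 p @ u = enc_prod e\<^sub>1 e\<^sub>2 q @ v"
  then have *: "e\<^sub>1 (fst p) @ (e\<^sub>2 (snd p) @ Close # u) = e\<^sub>1 (fst q) @ (e\<^sub>2 (snd q) @ Close # v)"
    by (simp add: enc_prod_def)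
  note 1 = self_delimitingD[OF assms(1) *]
  note 2 = self_delimitingD[OF assms(2) 1(2)]
  from 1 2 show "p = q \<and> u = v" by (simp add: prod_eq_iff)
qed (simp add: enc_prod_def)

lemma self_delimiting_list:
  assumes "self_delimiting e"
  shows "self_delimiting (enc_list e)"
proof -
  have hd: "e x @ u \<noteq> Close # v" for x u v
  proof
    assume "e x @ u = Close # v"
    moreover have "e x \<noteq> []" "hd (e x) \<noteq> Close"
      using assms unfolding self_delimiting_def by blast+
    ultimately show False by (cases "e x") simp_all
  qed
  have *: "xs = ys \<and> u = v"
    if "concat (map e xs) @ Close # u = concat (map e ys) @ Close # v" for xs ys u v
    using that
  proof (induction xs arbitrary: ys)
    case Nil
    then show ?case using hd[symmetric] by (cases ys) simp_all
  next
    case (Cons x xs)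
    show ?case
    proof (cases ys)
      case Nil
      with Cons.prems hd show ?thesis by simp
    next
      case (Cons y zs)
      with Cons.prems have
        "e x @ (concat (map e xs) @ Close # u) = e y @ (concat (map e zs) @ Close # v)"
        by simp
      note self_delimitingD[OF assms this]
      with Cons.IH[of zs] Cons show ?thesis by simp
    qed
  qed
  show ?thesis
    by (rule self_delimitingI) (simp_all add: enc_list_def *)
qed

lemma inj_enc_cnf: "inj enc_cnf"
  unfolding enc_cnf_def
  by (intro self_delimiting_imp_inj self_delimiting_list self_delimiting_prod self_delimiting_bool)

lemma self_delimiting_graph: "self_delimiting enc_graph"
  unfolding enc_graph_def
  by (intro self_delimiting_list self_delimiting_prod self_delimiting_bool)

lemma self_delimiting_nat: "self_delimiting enc_nat"
proof (rule self_delimitingI)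
  fix m n u v assume "enc_nat m @ u = enc_nat n @ v"
  from self_delimitingD[OF self_delimiting_list[OF self_delimiting_bool] this[unfolded enc_nat_def]]
  have "length (replicate m True) = length (replicate n True)" "u = v" by simp_all
  then show "m = n \<and> u = v" by simp
qed (simp add: enc_nat_def enc_list_def)

lemma inj_enc_graph_nat: "inj (enc_prod enc_graph enc_nat)"
  by (intro self_delimiting_imp_inj self_delimiting_prod self_delimiting_graph self_delimiting_nat)


section \<open>Reductions\<close>

text \<open>
  A polynomial-time reduction of the satisfiability problem to finding the value \<open>F G r\<close> for the
  root \<open>r\<close> of an AND/OR dag \<open>G\<close>: the reduction outputs the rooted graph and a number \<open>k\<close>, and the
  answer is read off by comparing the value found with \<open>k\<close>.
\<close>

definition sat_reduces_to_finding :: "(name and_or_graph \<Rightarrow> name \<Rightarrow> enat) \<Rightarrow> bool" where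
  "sat_reduces_to_finding F \<longleftrightarrow>
     (\<exists>(g :: cnf \<Rightarrow> graph_listing) (k :: cnf \<Rightarrow> nat).
        poly_time enc_cnf (enc_prod enc_graph enc_nat) (\<lambda>\<phi>. (g \<phi>, k \<phi>)) \<and>
        (\<forall>\<phi>. and_or_dag (graph_of (g \<phi>)) \<and> is_root (graph_of (g \<phi>)) (root_of (g \<phi>)) \<and>
           (satisfiable \<phi> \<longleftrightarrow> F (graph_of (g \<phi>)) (root_of (g \<phi>)) = enat (k \<phi>))))"

end

theory Submission
  imports Defs
begin

text \<open>
  The graph of a formula consists of an AND root above an OR node for every clause and an OR node
  for every variable \<open>v\<close>. Each literal occurrence \<open>i\<close> of the formula has its own two leaves \<open>(b, i)\<close>,
  where \<open>b\<close> is a truth value. The children of \<open>v\<close> are two AND nodes \<open>(b, v)\<close>, whose children are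
  the leaves \<open>(b, i)\<close> for all occurrences \<open>i\<close> of \<open>v\<close>, and a clause has the leaves \<open>(s, i)\<close> for its
  literals, of sign \<open>s\<close>, as children. Proving the root requires for every variable a value \<open>b\<close> all
  of whose leaves are solved, hence at least one leaf for every occurrence; exactly one suffices iff
  the chosen values satisfy all clauses. Thus the threshold is the number of occurrences: because
  the leaves belong to occurrences and not to variables, a machine can write the graph and the
  threshold in a single pass over the formula, without ever comparing two names. Exchanging OR with
  AND and solved with unsolved gives the result on disproof numbers.

  Two terminal leaves remove degenerate cases: an unsolvable child of every clause keeps an empty
  clause from being a leaf, and a guard node above both of them keeps the root from being a leaf and
  connects the unsolvable leaf to the root.
\<close>

section \<open>Generalities on AND/OR graphs\<close>

lemma children_add_solved [simp]: "children (G\<lparr>solved := A\<rparr>) = children G"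
  by (simp add: children_def fun_eq_iff)

lemma leaves_add_solved [simp]: "leaves (G\<lparr>solved := A\<rparr>) = leaves G"
  by (simp add: leaves_def nodes_def)

text \<open>Nonterminal leaves are leaves outside \<open>unsolved G\<close>, so the two kinds of
  terminal leaves stay disjoint. Hence the characterisations of solvability, which presuppose
  \<open>and_or_dag\<close>, apply to the extended graph.\<close>

lemma and_or_dag_add_solved:
  assumes "and_or_dag G" "S \<subseteq> nonterminal_leaves G"
  shows "and_or_dag (G\<lparr>solved := solved G \<union> S\<rparr>)"
  using assms by (auto simp: and_or_dag_def nodes_def nonterminal_leaves_def)

lemma solvable_leaf_iff: "x \<in> leaves G \<Longrightarrow> solvable G x \<longleftrightarrow> x \<in> solved G"
  by (subst solvable.simps) (auto simp: leaves_def)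

section \<open>Duality of proof and disproof numbers\<close>

definition dual :: "'v and_or_graph \<Rightarrow> 'v and_or_graph" where
  "dual G = \<lparr>or_nodes = and_nodes G, and_nodes = or_nodes G, edges = edges G,
     solved = unsolved G, unsolved = solved G\<rparr>"

lemma dual_simps [simp]:
  "or_nodes (dual G) = and_nodes G" "and_nodes (dual G) = or_nodes G" "edges (dual G) = edges G"
  "solved (dual G) = unsolved G" "unsolved (dual G) = solved G"
  by (simp_all add: dual_def)

lemma nodes_dual [simp]: "nodes (dual G) = nodes G"
  by (auto simp: dual_def nodes_def)

lemma children_dual [simp]: "children (dual G) = children G"
  by (simp add: dual_def children_def fun_eq_iff)

lemma leaves_dual [simp]: "leaves (dual G) = leaves G"
  by (simp add: leaves_def)

lemma and_or_dag_dual: "and_or_dag G \<Longrightarrow> and_or_dag (dual G)"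
  unfolding and_or_dag_def nodes_dual leaves_dual by (auto simp: dual_def)

lemma is_root_dual: "is_root G r \<Longrightarrow> is_root (dual G) r"
  unfolding is_root_def nodes_dual by simp

text \<open>The exchange carries the introduction rules of one predicate onto those of the other:
  \<open>leaf\<close> onto \<open>leaf\<close>, \<open>or_node\<close> onto \<open>and_node\<close>
  and vice versa.\<close>

lemma unsolvable_dual: "unsolvable (dual G) x \<longleftrightarrow> solvable G x"
proof
  show "solvable G x" if "unsolvable (dual G) x"
    using that
  proof (induction x rule: unsolvable.induct)
    case (leaf x)
    show ?case by (rule solvable.leaf) (use leaf in simp_all)
  next
    case (or_node x)
    show ?case by (rule solvable.and_node) (use or_node in simp_all)
  next
    case (and_node x y)
    show ?case by (rule solvable.or_node[of _ _ y]) (use and_node in simp_all)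
  qed
next
  show "unsolvable (dual G) x" if "solvable G x"
    using that
  proof (induction x rule: solvable.induct)
    case (leaf x)
    show ?case by (rule unsolvable.leaf) (use leaf in simp_all)
  next
    case (or_node x y)
    show ?case by (rule unsolvable.and_node[of _ _ y]) (use or_node in simp_all)
  next
    case (and_node x)
    show ?case by (rule unsolvable.or_node) (use and_node in simp_all)
  qed
qed

lemma disproof_number_dual: "disproof_number (dual G) x = proof_number G x"
proof -
  have eq: "(dual G)\<lparr>unsolved := solved G \<union> S\<rparr> = dual (G\<lparr>solved := solved G \<union> S\<rparr>)" for S
    by (simp add: dual_def)
  have nl: "nonterminal_leaves (dual G) = nonterminal_leaves G"
    unfolding nonterminal_leaves_def leaves_dual by (auto simp: dual_def)
  show ?thesis
    unfolding disproof_number_def proof_number_def dual_simps eq nl unsolvable_dual ..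
qed

text \<open>Cardinalities are well-ordered, so once \<open>m\<close> is known to be a lower bound,
  the infimum equals \<open>m\<close> exactly if some admissible set attains it. This turns the
  threshold into an existence question.\<close>

lemma proof_number_eq_iff:
  assumes "\<And>S. S \<subseteq> nonterminal_leaves G \<Longrightarrow> solvable (G\<lparr>solved := solved G \<union> S\<rparr>) x \<Longrightarrow> m \<le> card S"
  shows "proof_number G x = enat m \<longleftrightarrow>
    (\<exists>S. S \<subseteq> nonterminal_leaves G \<and> solvable (G\<lparr>solved := solved G \<union> S\<rparr>) x \<and> card S = m)"
proof -
  define A where "A = {S. S \<subseteq> nonterminal_leaves G \<and> solvable (G\<lparr>solved := solved G \<union> S\<rparr>) x}"
  have eq: "proof_number G x = (INF S \<in> A. enat (card S))"
    by (simp add: proof_number_def A_def)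
  have lb: "enat m \<le> (INF S \<in> A. enat (card S))"
    using assms by (intro INF_greatest) (simp add: A_def)
  have "(INF S \<in> A. enat (card S)) = enat m \<longleftrightarrow> (\<exists>S \<in> A. card S = m)"
  proof
    assume inf: "(INF S \<in> A. enat (card S)) = enat m"
    \<comment> \<open>The infimum of the empty set would be infinite. Over a nonempty set it is the
      least element, hence attained.\<close>
    then have "(\<lambda>S. enat (card S)) ` A \<noteq> {}" by (auto simp: Inf_enat_def)
    then have "(INF S \<in> A. enat (card S)) \<in> (\<lambda>S. enat (card S)) ` A"
      unfolding Inf_enat_def using LeastI_ex[of "\<lambda>y. y \<in> (\<lambda>S. enat (card S)) ` A"] by auto
    with inf show "\<exists>S \<in> A. card S = m" by auto
  next
    assume "\<exists>S \<in> A. card S = m"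
    then obtain S where "S \<in> A" "card S = m" by blast
    then have "(INF S \<in> A. enat (card S)) \<le> enat m" by (metis INF_lower)
    with lb show "(INF S \<in> A. enat (card S)) = enat m" by (rule order_antisym[rotated])
  qed
  then show ?thesis by (auto simp: eq A_def)
qed


section \<open>The graph of a formula\<close>

text \<open>
  The triple \<open>(c, i, l)\<close> says that the \<open>i\<close>-th literal occurrence of the whole formula lies in
  the \<open>c\<close>-th clause and is the literal \<open>l\<close>.
\<close>

fun clause_occs :: "nat \<Rightarrow> nat \<Rightarrow> literal list \<Rightarrow> (nat \<times> nat \<times> literal) list" where
  "clause_occs c i [] = []"
| "clause_occs c i (l # ls) = (c, i, l) # clause_occs c (Suc i) ls"

fun occs :: "nat \<Rightarrow> nat \<Rightarrow> cnf \<Rightarrow> (nat \<times> nat \<times> literal) list" where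
  "occs c i [] = []"
| "occs c i (C # \<phi>) = clause_occs c i C @ occs (Suc c) (i + length C) \<phi>"

text \<open>The walks list their items in the order of one left-to-right pass: \<open>e c\<close> on
  entering a clause, \<open>f c i l\<close> at each literal. Since the machine writes in the same
  order, its tapes can be compared with these lists symbol by symbol; \<open>set_walk\<close> then
  forgets the order.\<close>

fun clause_walk :: "(nat \<Rightarrow> nat \<Rightarrow> literal \<Rightarrow> 'x list) \<Rightarrow> nat \<Rightarrow> nat \<Rightarrow> literal list \<Rightarrow> 'x list" where
  "clause_walk f c i [] = []"
| "clause_walk f c i (l # ls) = f c i l @ clause_walk f c (Suc i) ls"

fun walk :: "(nat \<Rightarrow> 'x list) \<Rightarrow> (nat \<Rightarrow> nat \<Rightarrow> literal \<Rightarrow> 'x list) \<Rightarrow> nat \<Rightarrow> nat \<Rightarrow> cnf \<Rightarrow> 'x list" where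
  "walk e f c i [] = []"
| "walk e f c i (C # \<phi>) = e c @ clause_walk f c i C @ walk e f (Suc c) (i + length C) \<phi>"

lemma set_clause_walk: "set (clause_walk f c i C) = (\<Union>(c', j, l) \<in> set (clause_occs c i C). set (f c' j l))"
  by (induction C arbitrary: i) auto

lemma set_walk:
  "set (walk e f c i \<phi>) =
     (\<Union>c' \<in> {c..<c + length \<phi>}. set (e c')) \<union> (\<Union>(c', j, l) \<in> set (occs c i \<phi>). set (f c' j l))"
proof (induction \<phi> arbitrary: c i)
  case Nil
  then show ?case by simp
next
  case (Cons C \<phi>)
  have "{c..<c + length (C # \<phi>)} = insert c {Suc c..<Suc c + length \<phi>}" by auto
  then show ?case by (auto simp: Cons.IH set_clause_walk)
qed

lemma clause_occs_positions: "map (fst \<circ> snd) (clause_occs c i C) = [i..<i + length C]"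
  by (induction C arbitrary: i) (simp_all add: upt_conv_Cons del: upt_Suc)

text \<open>Positions are consecutive across clause boundaries. Started at \<open>0\<close>, every
  position below the number of occurrences is therefore used exactly once, which gives
  \<open>occs_less\<close>, \<open>occs_total\<close> and \<open>occs_unique\<close>.\<close>

lemma occs_positions: "map (fst \<circ> snd) (occs c i \<phi>) = [i..<i + length (concat \<phi>)]"
proof (induction \<phi> arbitrary: c i)
  case (Cons C \<phi>)
  show ?case
    using upt_add_eq_append[of i "i + length C" "length (concat \<phi>)"]
    by (simp only: occs.simps map_append Cons.IH clause_occs_positions concat.simps length_append
        add.assoc le_add1)
qed simp

lemma clause_occs_literals: "(\<exists>j. (c', j, l) \<in> set (clause_occs c i C)) \<longleftrightarrow> c' = c \<and> l \<in> set C"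
  by (induction C arbitrary: i) auto

lemma occs_literals:
  "(\<exists>j. (c', j, l) \<in> set (occs c i \<phi>)) \<longleftrightarrow> (\<exists>d < length \<phi>. c' = c + d \<and> l \<in> set (\<phi> ! d))"
proof (induction \<phi> arbitrary: c i)
  case (Cons C \<phi>)
  have "(\<exists>j. (c', j, l) \<in> set (occs c i (C # \<phi>))) \<longleftrightarrow>
      c' = c \<and> l \<in> set C \<or> (\<exists>d < length \<phi>. c' = Suc c + d \<and> l \<in> set (\<phi> ! d))"
    using clause_occs_literals[of c' l c i C] Cons.IH[of "Suc c" "i + length C"] by auto
  also have "\<dots> \<longleftrightarrow> (\<exists>d < length (C # \<phi>). c' = c + d \<and> l \<in> set ((C # \<phi>) ! d))"
    by (auto simp: less_Suc_eq_0_disj)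
  finally show ?case .
qed simp

lemma occs_less:
  assumes "(c, i, l) \<in> set (occs 0 0 \<phi>)"
  shows "i < length (concat \<phi>)" "c < length \<phi>" "l \<in> set (\<phi> ! c)"
proof -
  from assms have "(fst \<circ> snd) (c, i, l) \<in> set (map (fst \<circ> snd) (occs 0 0 \<phi>))"
    unfolding set_map by (rule imageI)
  then show "i < length (concat \<phi>)" unfolding occs_positions by simp
  show "c < length \<phi>" "l \<in> set (\<phi> ! c)" using assms occs_literals[of c l 0 0 \<phi>] by auto
qed

lemma occs_total:
  assumes "i < length (concat \<phi>)"
  obtains c s v where "(c, i, s, v) \<in> set (occs 0 0 \<phi>)"
proof -
  from assms have "i \<in> set (map (fst \<circ> snd) (occs 0 0 \<phi>))" unfolding occs_positions by simp
  then obtain x where "x \<in> set (occs 0 0 \<phi>)" "i = fst (snd x)" by auto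
  with that show thesis by (cases x) simp
qed

lemma occs_unique:
  assumes "(c, i, l) \<in> set (occs 0 0 \<phi>)" "(c', i, l') \<in> set (occs 0 0 \<phi>)"
  shows "c = c' \<and> l = l'"
proof -
  have "distinct (map (fst \<circ> snd) (occs 0 0 \<phi>))" unfolding occs_positions by simp
  then have "inj_on (fst \<circ> snd) (set (occs 0 0 \<phi>))" by (simp add: distinct_map)
  from inj_onD[OF this _ assms] show ?thesis by simp
qed

text \<open>The first two bits of the long names fix the kind of node, and each constant is too
  short to be one of them, so simplification separates the kinds. Positions and clause numbers are
  unary because they are copied verbatim from the unary counters of the machine.\<close>

abbreviation root_node :: name where "root_node \<equiv> []"
abbreviation top_node :: name where "top_node \<equiv> [False]"
abbreviation bot_node :: name where "bot_node \<equiv> [True]"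
abbreviation guard_node :: name where "guard_node \<equiv> [True, False]"
abbreviation var_node :: "name \<Rightarrow> name" where "var_node v \<equiv> False # False # v"
abbreviation sign_node :: "bool \<Rightarrow> name \<Rightarrow> name" where "sign_node b v \<equiv> False # True # b # v"
abbreviation leaf_node :: "bool \<Rightarrow> nat \<Rightarrow> name" where
  "leaf_node b i \<equiv> True # False # b # replicate i True"
abbreviation clause_node :: "nat \<Rightarrow> name" where "clause_node c \<equiv> True # True # replicate c True"

fun lit_ors :: "nat \<Rightarrow> nat \<Rightarrow> literal \<Rightarrow> name list" where
  "lit_ors c i (s, v) = [var_node v, leaf_node True i, leaf_node False i]"

fun lit_ands :: "nat \<Rightarrow> nat \<Rightarrow> literal \<Rightarrow> name list" where
  "lit_ands c i (s, v) = [sign_node True v, sign_node False v]"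

fun lit_edges :: "nat \<Rightarrow> nat \<Rightarrow> literal \<Rightarrow> (name \<times> name) list" where
  "lit_edges c i (s, v) =
     [(root_node, var_node v), (var_node v, sign_node True v), (var_node v, sign_node False v),
      (sign_node True v, leaf_node True i), (sign_node False v, leaf_node False i),
      (clause_node c, leaf_node s i)]"

definition clause_edges :: "nat \<Rightarrow> (name \<times> name) list" where
  "clause_edges c = [(root_node, clause_node c), (clause_node c, bot_node)]"

definition or_list :: "cnf \<Rightarrow> name list" where
  "or_list \<phi> = [top_node, bot_node, guard_node] @ walk (\<lambda>c. [clause_node c]) lit_ors 0 0 \<phi>"

definition and_list :: "cnf \<Rightarrow> name list" where
  "and_list \<phi> = [root_node] @ walk (\<lambda>c. []) lit_ands 0 0 \<phi>"

definition edge_list :: "cnf \<Rightarrow> (name \<times> name) list" where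
  "edge_list \<phi> = [(root_node, guard_node), (guard_node, top_node), (guard_node, bot_node)] @ walk clause_edges lit_edges 0 0 \<phi>"

definition cnf_graph :: "cnf \<Rightarrow> graph_listing" where
  "cnf_graph \<phi> = (or_list \<phi>, and_list \<phi>, edge_list \<phi>, [top_node], [bot_node], root_node)"

definition dual_cnf_graph :: "cnf \<Rightarrow> graph_listing" where
  "dual_cnf_graph \<phi> = (and_list \<phi>, or_list \<phi>, edge_list \<phi>, [bot_node], [top_node], root_node)"

lemma dual_cnf_graph: "graph_of (dual_cnf_graph \<phi>) = dual (graph_of (cnf_graph \<phi>))"
  by (simp add: dual_cnf_graph_def cnf_graph_def dual_def)

section \<open>Structure of the graph of a fixed formula and correctness of the threshold\<close>

context
  fixes \<phi> :: cnf and G :: "name and_or_graph"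
  defines "G \<equiv> graph_of (cnf_graph \<phi>)"
begin

private abbreviation (input) "occ \<equiv> set (occs 0 0 \<phi>)"
private abbreviation (input) "n \<equiv> length \<phi>"
private abbreviation (input) "m \<equiv> length (concat \<phi>)"

lemma or_nodes_G:
  "or_nodes G = {top_node, bot_node, guard_node} \<union> (\<Union>c \<in> {..<n}. {clause_node c}) \<union>
     (\<Union>(c, i, s, v) \<in> occ. {var_node v, leaf_node True i, leaf_node False i})"
proof -
  have "set (lit_ors c i l) = (case l of (s, v) \<Rightarrow> {var_node v, leaf_node True i, leaf_node False i})"
    for c i l by (cases l) simp
  then show ?thesis
    by (simp add: G_def cnf_graph_def or_list_def set_walk atLeast0LessThan Un_assoc)
qed

lemma and_nodes_G:
  "and_nodes G = {root_node} \<union> (\<Union>(c, i, s, v) \<in> occ. {sign_node True v, sign_node False v})"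
proof -
  have "set (lit_ands c i l) = (case l of (s, v) \<Rightarrow> {sign_node True v, sign_node False v})"
    for c i l by (cases l) simp
  then show ?thesis
    by (simp add: G_def cnf_graph_def and_list_def set_walk)
qed

lemma edges_G:
  "edges G = {(root_node, guard_node), (guard_node, top_node), (guard_node, bot_node)} \<union>
     (\<Union>c \<in> {..<n}. {(root_node, clause_node c), (clause_node c, bot_node)}) \<union>
     (\<Union>(c, i, s, v) \<in> occ. {(root_node, var_node v), (var_node v, sign_node True v),
        (var_node v, sign_node False v), (sign_node True v, leaf_node True i),
        (sign_node False v, leaf_node False i), (clause_node c, leaf_node s i)})"
proof -
  have "set (lit_edges c i l) = (case l of (s, v) \<Rightarrow>
      {(root_node, var_node v), (var_node v, sign_node True v),
       (var_node v, sign_node False v), (sign_node True v, leaf_node True i),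
       (sign_node False v, leaf_node False i), (clause_node c, leaf_node s i)})"
    for c i l by (cases l) simp
  then show ?thesis
    by (simp add: G_def cnf_graph_def edge_list_def clause_edges_def set_walk atLeast0LessThan Un_assoc)
qed

text \<open>The set equations spell out the two truth values separately; these rules leave
  \<open>b\<close> free, so that later arguments treat both values at once.\<close>

lemma or_nodes_intros:
  "c < n \<Longrightarrow> clause_node c \<in> or_nodes G"
  "(c, i, s, v) \<in> occ \<Longrightarrow> var_node v \<in> or_nodes G"
  "(c, i, s, v) \<in> occ \<Longrightarrow> leaf_node b i \<in> or_nodes G"
  "top_node \<in> or_nodes G" "bot_node \<in> or_nodes G" "guard_node \<in> or_nodes G"
proof -
  assume "c < n"
  then show "clause_node c \<in> or_nodes G" unfolding or_nodes_G by blast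
next
  assume occ: "(c, i, s, v) \<in> occ"
  show "var_node v \<in> or_nodes G"
    unfolding or_nodes_G by (rule UnI2, rule UN_I[OF occ]) simp
  show "leaf_node b i \<in> or_nodes G"
    unfolding or_nodes_G by (rule UnI2, rule UN_I[OF occ]) (cases b, simp_all)
qed (simp_all add: or_nodes_G)

lemma and_nodes_intros:
  "root_node \<in> and_nodes G"
  "(c, i, s, v) \<in> occ \<Longrightarrow> sign_node b v \<in> and_nodes G"
proof -
  assume occ: "(c, i, s, v) \<in> occ"
  show "sign_node b v \<in> and_nodes G"
    unfolding and_nodes_G by (rule UnI2, rule UN_I[OF occ]) (cases b, simp_all)
qed (simp add: and_nodes_G)

lemma edges_intros:
  "(root_node, guard_node) \<in> edges G" "(guard_node, top_node) \<in> edges G"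
  "(guard_node, bot_node) \<in> edges G"
  "c < n \<Longrightarrow> (root_node, clause_node c) \<in> edges G"
  "(c, i, s, v) \<in> occ \<Longrightarrow> (root_node, var_node v) \<in> edges G"
  "(c, i, s, v) \<in> occ \<Longrightarrow> (var_node v, sign_node b v) \<in> edges G"
  "(c, i, s, v) \<in> occ \<Longrightarrow> (sign_node b v, leaf_node b i) \<in> edges G"
proof -
  assume "c < n"
  then show "(root_node, clause_node c) \<in> edges G" unfolding edges_G by blast
next
  assume occ: "(c, i, s, v) \<in> occ"
  show "(root_node, var_node v) \<in> edges G"
    unfolding edges_G by (rule UnI2, rule UN_I[OF occ]) simp
  show "(var_node v, sign_node b v) \<in> edges G"
    unfolding edges_G by (rule UnI2, rule UN_I[OF occ]) (cases b, simp_all)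
  show "(sign_node b v, leaf_node b i) \<in> edges G"
    unfolding edges_G by (rule UnI2, rule UN_I[OF occ]) (cases b, simp_all)
qed (simp_all add: edges_G)

lemma solved_G: "solved G = {top_node}" "unsolved G = {bot_node}"
  by (simp_all add: G_def cnf_graph_def)

lemma children_root:
  "children G root_node = {guard_node} \<union> clause_node ` {..<n} \<union> (\<Union>(c, i, s, v) \<in> occ. {var_node v})"
  unfolding children_def edges_G by auto

lemma children_guard: "children G guard_node = {top_node, bot_node}"
  unfolding children_def edges_G by auto

lemma children_clause:
  "c < n \<Longrightarrow> children G (clause_node c) = {bot_node} \<union> {leaf_node s i | i s v. (c, i, s, v) \<in> occ}"
  unfolding children_def edges_G by auto

lemma children_var:
  "(c, i, s, v) \<in> occ \<Longrightarrow> children G (var_node v) = {sign_node True v, sign_node False v}"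
  unfolding children_def edges_G by auto

lemma children_sign:
  "children G (sign_node b v) = {leaf_node b i | c i s. (c, i, s, v) \<in> occ}"
  unfolding children_def edges_G by (cases b) auto

lemma children_leaf:
  "children G (leaf_node b i) = {}" "children G top_node = {}" "children G bot_node = {}"
  unfolding children_def edges_G by auto

text \<open>All other nodes have children: the root has the guard, the guard the two constants, a
  clause \<open>bot_node\<close>, a variable its sign nodes, and a sign node the leaf of an
  occurrence that gave rise to it. Conversely, by \<open>occs_total\<close> every position below
  \<open>m\<close> belongs to an occurrence, so its leaves are nodes.\<close>

lemma leaves_G: "leaves G = {top_node, bot_node} \<union> {leaf_node b i | b i. i < m}"
proof -
  have 1: "leaf_node b i \<in> or_nodes G" if "i < m" for b i
  proof -
    from occs_total[OF that] obtain c s v where "(c, i, s, v) \<in> occ" .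
    then show ?thesis by (rule or_nodes_intros)
  qed
  have 2: "top_node \<in> or_nodes G" "bot_node \<in> or_nodes G"
    by (rule or_nodes_intros)+
  have 3: "x \<in> {top_node, bot_node} \<union> {leaf_node b i | b i. i < m}"
    if "x \<in> or_nodes G" "children G x = {}" for x
  proof -
    from that(1) consider "x \<in> {top_node, bot_node}" | "x = guard_node" | c where "c < n" "x = clause_node c"
      | c i s v where "(c, i, s, v) \<in> occ" "x = var_node v"
      | c i s v b where "(c, i, s, v) \<in> occ" "x = leaf_node b i"
      unfolding or_nodes_G by blast
    then show ?thesis
    proof cases
      case 1
      then show ?thesis by blast
    next
      case 2
      with that(2) show ?thesis by (simp add: children_guard)
    next
      case 3
      with that(2) show ?thesis by (simp add: children_clause)
    next
      case 4
      with that(2) show ?thesis by (simp add: children_var)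
    next
      case 5
      then show ?thesis using occs_less(1)[OF 5(1)] by blast
    qed
  qed
  have 4: "children G x \<noteq> {}" if "x \<in> and_nodes G" for x
  proof -
    from that consider "x = root_node" | c i s v b where "(c, i, s, v) \<in> occ" "x = sign_node b v"
      unfolding and_nodes_G by blast
    then show ?thesis
    proof cases
      case 1
      then show ?thesis by (simp add: children_root)
    next
      case 2
      then show ?thesis by (auto simp: children_sign)
    qed
  qed
  show ?thesis
    unfolding leaves_def nodes_def using 1 2 3 4 children_leaf by blast
qed

lemma nonterminal_leaves_G: "nonterminal_leaves G = {leaf_node b i | b i. i < m}"
  unfolding nonterminal_leaves_def leaves_G solved_G by auto

text \<open>The level of a node, read off the prefix of its name: clauses, variables and the guard
  lie on level 1, sign nodes on level 2, all leaves on level 3. Every edge leads to a strictly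
  larger level, which makes the graph acyclic.\<close>

fun depth :: "name \<Rightarrow> nat" where
  "depth [] = 0"
| "depth [b] = 3"
| "depth (True # True # w) = 1"
| "depth (False # False # w) = 1"
| "depth (False # True # w) = 2"
| "depth [True, False] = 1"
| "depth (True # False # b # w) = 3"

lemma and_or_dag_G: "and_or_dag G"
proof -
  have "finite (nodes G)"
    by (simp add: nodes_def G_def cnf_graph_def)
  moreover have "or_nodes G \<inter> and_nodes G = {}"
    unfolding or_nodes_G and_nodes_G by auto
  moreover have "edges G \<subseteq> nodes G \<times> nodes G"
  proof -
    have clause: "clause_node c \<in> nodes G" if "c < n" for c
      using that by (simp add: nodes_def or_nodes_intros)
    have occ: "var_node v \<in> nodes G" "sign_node b v \<in> nodes G" "leaf_node b i \<in> nodes G"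
      "clause_node c \<in> nodes G" if "(c, i, s, v) \<in> occ" for c i s v b
      using or_nodes_intros(1)[OF occs_less(2)[OF that]] or_nodes_intros(2,3)[OF that]
        and_nodes_intros(2)[OF that] unfolding nodes_def by blast+
    have "root_node \<in> nodes G" "top_node \<in> nodes G" "bot_node \<in> nodes G"
      "guard_node \<in> nodes G"
      using or_nodes_intros(4-6) and_nodes_intros(1) unfolding nodes_def by blast+
    with clause occ show ?thesis unfolding edges_G by blast
  qed
  moreover have "acyclic (edges G)"
  proof -
    have "edges G \<subseteq> measure depth"
      unfolding edges_G by auto
    with wf_acyclic[OF wf_measure] show ?thesis by (rule acyclic_subset)
  qed
  ultimately show ?thesis by (simp add: and_or_dag_def solved_G leaves_G)
qed

lemma is_root_G: "is_root G root_node"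
proof -
  have "(root_node, x) \<in> (edges G)\<^sup>*" if "x \<in> nodes G" for x
  proof -
    have var: "(root_node, var_node v) \<in> (edges G)\<^sup>*" if "(c, i, s, v) \<in> occ" for c i s v
      using edges_intros(5)[OF that] by (rule r_into_rtrancl)
    have sign: "(root_node, sign_node b v) \<in> (edges G)\<^sup>*" if "(c, i, s, v) \<in> occ" for c i s v b
      using var[OF that] edges_intros(6)[OF that] by (rule rtrancl_into_rtrancl)
    have leaf: "(root_node, leaf_node b i) \<in> (edges G)\<^sup>*" if "(c, i, s, v) \<in> occ" for c i s v b
      using sign[OF that] edges_intros(7)[OF that] by (rule rtrancl_into_rtrancl)
    have clause: "(root_node, clause_node c) \<in> (edges G)\<^sup>*" if "c < n" for c
      using edges_intros(4)[OF that] by (rule r_into_rtrancl)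
    have guard: "(root_node, guard_node) \<in> (edges G)\<^sup>*"
      using edges_intros(1) by (rule r_into_rtrancl)
    have const: "(root_node, top_node) \<in> (edges G)\<^sup>*" "(root_node, bot_node) \<in> (edges G)\<^sup>*"
      using rtrancl_into_rtrancl[OF guard edges_intros(2)]
        rtrancl_into_rtrancl[OF guard edges_intros(3)] .
    show ?thesis
      using that var sign leaf clause guard const
      unfolding nodes_def or_nodes_G and_nodes_G by blast
  qed
  then show ?thesis by (simp add: is_root_def nodes_def and_nodes_G)
qed

text \<open>The propagation rules are evaluated from the leaves upwards. The guard is always
  solvable and drops out of the root's conjunction; \<open>bot_node\<close> never is and drops out
  of each clause's disjunction. The clauses yield the first conjunct, the variables the
  second.\<close>

lemma solvable_root_iff:
  assumes "S \<subseteq> nonterminal_leaves G"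
  shows "solvable (G\<lparr>solved := solved G \<union> S\<rparr>) root_node \<longleftrightarrow>
    (\<forall>c < n. \<exists>i s v. (c, i, s, v) \<in> occ \<and> leaf_node s i \<in> S) \<and>
    (\<forall>c i s v. (c, i, s, v) \<in> occ \<longrightarrow>
       (\<exists>b. \<forall>c' i' s'. (c', i', s', v) \<in> occ \<longrightarrow> leaf_node b i' \<in> S))"
proof -
  define H where "H = G\<lparr>solved := solved G \<union> S\<rparr>"
  have dag: "and_or_dag H" unfolding H_def by (rule and_or_dag_add_solved[OF and_or_dag_G assms])
  have H [simp]: "or_nodes H = or_nodes G" "and_nodes H = and_nodes G" "children H = children G"
    "leaves H = leaves G" "solved H = insert top_node S"
    by (simp_all add: H_def solved_G)
  note or_iff = solvable_or_node_iff[OF dag, unfolded H]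
    and and_iff = solvable_and_node_iff[OF dag, unfolded H]
  have inner: "x \<notin> leaves G" if "children G x \<noteq> {}" for x
    using that by (simp add: leaves_def)
  \<comment> \<open>\<open>S\<close> consists of nonterminal leaves and therefore cannot contain
    \<open>bot_node\<close>.\<close>
  have bot: "\<not> solvable H bot_node"
    using solvable_leaf_iff[of bot_node H] assms by (auto simp: leaves_G nonterminal_leaves_G)
  have top: "solvable H top_node"
    using solvable_leaf_iff[of top_node H] by (simp add: leaves_G)
  have leaf: "solvable H (leaf_node b i) \<longleftrightarrow> leaf_node b i \<in> S" if "(c, i, s, v) \<in> occ" for b c i s v
    using solvable_leaf_iff[of "leaf_node b i" H] occs_less(1)[OF that] by (auto simp: leaves_G)
  have sign: "solvable H (sign_node b v) \<longleftrightarrow>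
      (\<forall>c' i' s'. (c', i', s', v) \<in> occ \<longrightarrow> leaf_node b i' \<in> S)" if "(c, i, s, v) \<in> occ" for b c i s v
  proof -
    have "sign_node b v \<notin> leaves G"
      by (rule inner) (use that in \<open>auto simp: children_sign\<close>)
    from and_iff[OF and_nodes_intros(2)[OF that] this] show ?thesis
      unfolding children_sign using leaf by blast
  qed
  have var: "solvable H (var_node v) \<longleftrightarrow>
      (\<exists>b. \<forall>c' i' s'. (c', i', s', v) \<in> occ \<longrightarrow> leaf_node b i' \<in> S)" if "(c, i, s, v) \<in> occ" for c i s v
  proof -
    have "var_node v \<notin> leaves G"
      by (rule inner) (simp add: children_var[OF that])
    from or_iff[OF or_nodes_intros(2)[OF that] this] show ?thesis
      unfolding children_var[OF that] using sign[OF that] by (simp add: ex_bool_eq)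
  qed
  have clause: "solvable H (clause_node c) \<longleftrightarrow> (\<exists>i s v. (c, i, s, v) \<in> occ \<and> leaf_node s i \<in> S)"
    if "c < n" for c
  proof -
    have "clause_node c \<notin> leaves G"
      by (rule inner) (simp add: children_clause[OF that])
    from or_iff[OF or_nodes_intros(1)[OF that] this] show ?thesis
      unfolding children_clause[OF that] using bot leaf by blast
  qed
  have guard: "solvable H guard_node"
    using or_iff[OF or_nodes_intros(6) inner] top by (simp add: children_guard)
  have "solvable H root_node \<longleftrightarrow> (\<forall>y \<in> children G root_node. solvable H y)"
    by (rule and_iff[OF and_nodes_intros(1) inner]) (simp add: children_root)
  also have "\<dots> \<longleftrightarrow> (\<forall>c < n. solvable H (clause_node c)) \<and>
      (\<forall>c i s v. (c, i, s, v) \<in> occ \<longrightarrow> solvable H (var_node v))"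
    unfolding children_root using guard by blast
  finally show ?thesis
    unfolding H_def[symmetric] using clause var by simp
qed

text \<open>The position can be recovered from a leaf's name, so one chosen leaf per position makes
  \<open>m\<close> distinct elements of \<open>S\<close>. If \<open>S\<close> has no more elements
  than these, it contains at each position only the chosen truth value.\<close>

lemma card_ge:
  assumes "S \<subseteq> nonterminal_leaves G" "\<And>i. i < m \<Longrightarrow> leaf_node (\<beta> i) i \<in> S"
  shows "m \<le> card S" "card S = m \<Longrightarrow> leaf_node b i \<in> S \<Longrightarrow> b = \<beta> i"
proof -
  have "nonterminal_leaves G \<subseteq> nodes G"
    by (auto simp: nonterminal_leaves_def leaves_def)
  with assms(1) and_or_dag_G have fin: "finite S"
    unfolding and_or_dag_def by (meson finite_subset)
  let ?T = "(\<lambda>i. leaf_node (\<beta> i) i) ` {..<m}"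
  have "inj_on (\<lambda>i. leaf_node (\<beta> i) i) {..<m}"
    by (rule inj_onI) simp
  then have card: "card ?T = m" by (simp add: card_image)
  have sub: "?T \<subseteq> S" using assms(2) by blast
  show "m \<le> card S" using card_mono[OF fin sub] card by simp
  assume "card S = m" "leaf_node b i \<in> S"
  with card_subset_eq[OF fin sub] card have "leaf_node b i \<in> ?T" by simp
  then show "b = \<beta> i" by auto
qed

lemma proof_number_G: "proof_number G root_node = enat m \<longleftrightarrow> satisfiable \<phi>"
proof -
  have choice: "\<exists>\<alpha>. \<forall>c i s v. (c, i, s, v) \<in> occ \<longrightarrow> leaf_node (\<alpha> v) i \<in> S"
    if S: "S \<subseteq> nonterminal_leaves G" "solvable (G\<lparr>solved := solved G \<union> S\<rparr>) root_node" for S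
  proof -
    \<comment> \<open>A name that does not occur in the formula satisfies the condition vacuously,
      so a value can be chosen for every name.\<close>
    from S(2)[unfolded solvable_root_iff[OF S(1)]]
    have "\<forall>v. \<exists>b. \<forall>c' i' s'. (c', i', s', v) \<in> occ \<longrightarrow> leaf_node b i' \<in> S" by blast
    then show ?thesis by metis
  qed
  \<comment> \<open>The variable as a function of the position, well-defined by
    \<open>occs_unique\<close>. It turns an assignment into a choice of truth value per position,
    the form that \<open>card_ge\<close> expects.\<close>
  have var_of: "\<exists>u. \<forall>c i s v. (c, i, s, v) \<in> occ \<longrightarrow> u i = v"
  proof -
    have "\<forall>i. \<exists>w. \<forall>c s v. (c, i, s, v) \<in> occ \<longrightarrow> w = v"
      using occs_unique[of _ _ _ \<phi>] by (metis prod.inject)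
    then show ?thesis by metis
  qed
  then obtain u where u: "\<And>c i s v. (c, i, s, v) \<in> occ \<Longrightarrow> u i = v" by blast
  have leaf: "leaf_node (\<alpha> (u i)) i \<in> S"
    if "\<forall>c i s v. (c, i, s, v) \<in> occ \<longrightarrow> leaf_node (\<alpha> v) i \<in> S" "i < m" for \<alpha> i S
  proof -
    from occs_total[OF that(2)] obtain c s v where "(c, i, s, v) \<in> occ" .
    with that(1) u show ?thesis by blast
  qed
  have lb: "m \<le> card S"
    if S: "S \<subseteq> nonterminal_leaves G" "solvable (G\<lparr>solved := solved G \<union> S\<rparr>) root_node" for S
  proof -
    from choice[OF that] obtain \<alpha>
      where "\<forall>c i s v. (c, i, s, v) \<in> occ \<longrightarrow> leaf_node (\<alpha> v) i \<in> S" by blast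
    from card_ge(1)[OF S(1) leaf[OF this]] show ?thesis .
  qed
  have iff: "proof_number G root_node = enat m \<longleftrightarrow> (\<exists>S. S \<subseteq> nonterminal_leaves G \<and>
      solvable (G\<lparr>solved := solved G \<union> S\<rparr>) root_node \<and> card S = m)"
    by (rule proof_number_eq_iff) (rule lb)
  have sat_iff: "satisfiable \<phi> \<longleftrightarrow> (\<exists>\<alpha>. \<forall>c < n. \<exists>i s v. (c, i, s, v) \<in> occ \<and> \<alpha> v = s)"
  proof -
    have "(\<exists>i s v. (c, i, s, v) \<in> occ \<and> \<alpha> v = s) \<longleftrightarrow> (\<exists>(s, v) \<in> set (\<phi> ! c). \<alpha> v = s)"
      if "c < n" for c and \<alpha> :: "name \<Rightarrow> bool"
    proof -
      have "(\<exists>i. (c, i, l) \<in> occ) \<longleftrightarrow> l \<in> set (\<phi> ! c)" for l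
        using that by (simp add: occs_literals)
      then have "(\<exists>i s v. (c, i, s, v) \<in> occ \<and> \<alpha> v = s) \<longleftrightarrow> (\<exists>s v. (s, v) \<in> set (\<phi> ! c) \<and> \<alpha> v = s)"
        by blast
      then show ?thesis by (simp add: Bex_def split_paired_Ex)
    qed
    then show ?thesis
      unfolding satisfiable_def by (simp add: all_set_conv_all_nth)
  qed
  show ?thesis
  proof
    assume "proof_number G root_node = enat m"
    then obtain S where S: "S \<subseteq> nonterminal_leaves G"
      "solvable (G\<lparr>solved := solved G \<union> S\<rparr>) root_node" "card S = m"
      unfolding iff by (elim exE conjE)
    from choice[OF S(1,2)] obtain \<alpha>
      where \<alpha>: "\<forall>c i s v. (c, i, s, v) \<in> occ \<longrightarrow> leaf_node (\<alpha> v) i \<in> S" by blast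
    have "\<exists>i s v. (c, i, s, v) \<in> occ \<and> \<alpha> v = s" if "c < n" for c
    proof -
      from S(2)[unfolded solvable_root_iff[OF S(1)]] that
      obtain i s v where *: "(c, i, s, v) \<in> occ" "leaf_node s i \<in> S" by blast
      \<comment> \<open>With only \<open>m\<close> elements, \<open>S\<close> has one leaf per
        position. The leaf that proves the clause is thus the one chosen for its variable, and the
        literal is true.\<close>
      have "s = \<alpha> (u i)"
        by (rule card_ge(2)[OF S(1) leaf[OF \<alpha>] S(3) *(2)])
      with u[OF *(1)] *(1) show ?thesis by blast
    qed
    then show "satisfiable \<phi>" unfolding sat_iff by blast
  next
    assume "satisfiable \<phi>"
    then obtain \<alpha> where \<alpha>: "\<And>c. c < n \<Longrightarrow> \<exists>i s v. (c, i, s, v) \<in> occ \<and> \<alpha> v = s"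
      unfolding sat_iff by blast
    \<comment> \<open>Conversely, a satisfying assignment selects at each position the leaf carrying
      the value of the variable there.\<close>
    define S where "S = (\<lambda>i. leaf_node (\<alpha> (u i)) i) ` {..<m}"
    have sub: "S \<subseteq> nonterminal_leaves G" unfolding S_def nonterminal_leaves_G by blast
    have "inj_on (\<lambda>i. leaf_node (\<alpha> (u i)) i) {..<m}"
      by (rule inj_onI) simp
    then have card: "card S = m" unfolding S_def by (simp add: card_image)
    have in_S: "leaf_node (\<alpha> v) i \<in> S" if "(c, i, s, v) \<in> occ" for c i s v
      using u[OF that] occs_less(1)[OF that] unfolding S_def by blast
    have "solvable (G\<lparr>solved := solved G \<union> S\<rparr>) root_node"
      unfolding solvable_root_iff[OF sub] using in_S \<alpha> by metis
    with sub card show "proof_number G root_node = enat m"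
      unfolding iff by (intro exI[of _ S] conjI)
  qed
qed

end


section \<open>Combining Turing machines\<close>

text \<open>As a halted machine idles, \<open>t\<close> only bounds the number of steps, and bounds
  may be rounded up freely.\<close>

definition runs :: "tm \<Rightarrow> tape list \<Rightarrow> nat \<Rightarrow> tape list \<Rightarrow> bool" where
  "runs M ts t ts' \<longleftrightarrow> (step M ^^ t) (0, ts) = (num_states M, ts')"

lemma step_idle: "\<not> q < num_states M \<Longrightarrow> step M (q, ts) = (q, ts)"
  by (simp add: step_def)

lemma funpow_step_idle: "\<not> q < num_states M \<Longrightarrow> (step M ^^ t) (q, ts) = (q, ts)"
  by (induction t) (simp_all add: step_idle)

lemma step_trans:
  "q < num_states M \<Longrightarrow> trans M q (map read_tape ts) = (q', as) \<Longrightarrow>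
     step M (q, ts) = (q', map2 act_tape as ts)"
  by (simp add: step_def)

lemma runs_mono:
  assumes "runs M ts t ts'" "t \<le> t'"
  shows "runs M ts t' ts'"
proof -
  from assms(2) obtain d where "t' = d + t" using le_iff_add add.commute by metis
  with assms(1) show ?thesis by (simp add: runs_def funpow_add funpow_step_idle)
qed

lemma runs_compose:
  assumes "(step M ^^ t) (0, ts) = (q, ts')" "(step M ^^ t') (q, ts') = (num_states M, ts'')"
    "t + t' \<le> u"
  shows "runs M ts u ts''"
proof -
  have "runs M ts (t' + t) ts''" by (simp add: runs_def funpow_add assms)
  then show ?thesis using assms(3) by (auto intro: runs_mono)
qed

text \<open>\<open>M'\<close> contains a copy of \<open>M\<close> with states renamed by
  \<open>h\<close>, and a run of \<open>M\<close> is replayed there. The time is only bounded by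
  \<open>t\<close>: where \<open>M\<close> would idle, \<open>M'\<close> may already move on,
  because \<open>h (num_states M)\<close> need not be a halting state.\<close>

lemma embedded_run:
  assumes "\<And>q xs. q < num_states M \<Longrightarrow>
      h q < num_states M' \<and> trans M' (h q) xs = apfst h (trans M q xs)"
    and "(step M ^^ t) (q, ts) = (num_states M, ts')"
  shows "\<exists>t' \<le> t. (step M' ^^ t') (h q, ts) = (h (num_states M), ts')"
  using assms(2)
proof (induction t arbitrary: q ts)
  case 0
  then show ?case by simp
next
  case (Suc t)
  show ?case
  proof (cases "q < num_states M")
    case False
    with Suc.prems have "q = num_states M" "ts = ts'" by (simp_all del: funpow.simps add: funpow_step_idle)
    then show ?thesis by (intro exI[of _ 0]) simp
  next
    case True
    obtain q' as where tr: "trans M q (map read_tape ts) = (q', as)" by fastforce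
    from Suc.prems have "(step M ^^ t) (q', map2 act_tape as ts) = (num_states M, ts')"
      by (simp add: funpow_Suc_right step_trans[OF True tr] del: funpow.simps)
    from Suc.IH[OF this] obtain t' where
      t': "t' \<le> t" "(step M' ^^ t') (h q', map2 act_tape as ts) = (h (num_states M), ts')" by blast
    have "step M' (h q, ts) = (h q', map2 act_tape as ts)"
      using assms(1)[OF True, of "map read_tape ts"] tr by (intro step_trans) auto
    with t' show ?thesis
      by (intro exI[of _ "Suc t'"]) (simp add: funpow_Suc_right del: funpow.simps)
  qed
qed

section \<open>Sequencing, branching and loops for eight-tape machines\<close>

definition skip :: tm where
  "skip = \<lparr>num_tapes = 8, num_states = 0, trans = \<lambda>q xs. (0, [])\<rparr>"

definition act :: "(sym option list \<Rightarrow> (sym option \<times> move) list) \<Rightarrow> tm" where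
  "act f = \<lparr>num_tapes = 8, num_states = 1, trans = \<lambda>q xs. (1, f xs)\<rparr>"

definition seq :: "tm \<Rightarrow> tm \<Rightarrow> tm" where
  "seq M\<^sub>1 M\<^sub>2 = \<lparr>num_tapes = 8, num_states = num_states M\<^sub>1 + num_states M\<^sub>2,
     trans = \<lambda>q xs. if q < num_states M\<^sub>1 then trans M\<^sub>1 q xs
       else apfst ((+) (num_states M\<^sub>1)) (trans M\<^sub>2 (q - num_states M\<^sub>1) xs)\<rparr>"

definition seqs :: "tm list \<Rightarrow> tm" where
  "seqs Ms = foldr seq Ms skip"

abbreviation keep :: "sym option list \<Rightarrow> (sym option \<times> move) list" where
  "keep xs \<equiv> map (\<lambda>x. (x, Stay)) xs"

text \<open>State \<open>0\<close> performs the test, the states of the first branch follow, then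
  those of the second. The renaming \<open>h\<close> diverts the halting state of the first branch,
  which would otherwise become the start of the second, to the common end; \<open>h 0\<close> also
  covers a first branch without states.\<close>

definition cond :: "(sym option list \<Rightarrow> bool) \<Rightarrow> tm \<Rightarrow> tm \<Rightarrow> tm" where
  "cond c M\<^sub>1 M\<^sub>2 =
     (let n\<^sub>1 = num_states M\<^sub>1; n = Suc (n\<^sub>1 + num_states M\<^sub>2); h = (\<lambda>q. if q = n\<^sub>1 then n else Suc q)
      in \<lparr>num_tapes = 8, num_states = n,
           trans = \<lambda>q xs. if q = 0 then (if c xs then h 0 else Suc n\<^sub>1, keep xs)
             else if q \<le> n\<^sub>1 then apfst h (trans M\<^sub>1 (q - 1) xs)
             else apfst ((+) (Suc n\<^sub>1)) (trans M\<^sub>2 (q - Suc n\<^sub>1) xs)\<rparr>)"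

text \<open>The halting state of the body is identified with the test state \<open>0\<close>, so
  that completing the body leads directly to the next test.\<close>

definition while :: "(sym option list \<Rightarrow> bool) \<Rightarrow> tm \<Rightarrow> tm" where
  "while c M =
     (let n = num_states M; h = (\<lambda>q. if q = n then 0 else Suc q)
      in \<lparr>num_tapes = 8, num_states = Suc n,
           trans = \<lambda>q xs. if q = 0 then (if c xs then h 0 else Suc n, keep xs)
             else apfst h (trans M (q - 1) xs)\<rparr>)"

definition wf8 :: "tm \<Rightarrow> bool" where
  "wf8 M \<longleftrightarrow> wf_tm M \<and> num_tapes M = 8"

lemma wf8_iff:
  "wf8 M \<longleftrightarrow> num_tapes M = 8 \<and> (\<forall>q < num_states M. \<forall>xs. length xs = 8 \<longrightarrow>
     fst (trans M q xs) \<le> num_states M \<and> length (snd (trans M q xs)) = 8)"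
  by (auto simp: wf8_def wf_tm_def)

lemma wf8_skip: "wf8 skip"
  by (simp add: wf8_iff skip_def)

lemma wf8_act: "(\<And>xs. length xs = 8 \<Longrightarrow> length (f xs) = 8) \<Longrightarrow> wf8 (act f)"
  by (simp add: wf8_iff act_def)

lemma wf8D:
  assumes "wf8 M" "q < num_states M" "length xs = 8"
  shows "fst (trans M q xs) \<le> num_states M" "length (snd (trans M q xs)) = 8"
  using assms by (simp_all add: wf8_iff)

lemma wf8_seq:
  assumes "wf8 M\<^sub>1" "wf8 M\<^sub>2"
  shows "wf8 (seq M\<^sub>1 M\<^sub>2)"
  using assms[THEN wf8D(1)] assms[THEN wf8D(2)]
  unfolding wf8_iff seq_def by (simp add: trans_le_add1)

lemma wf8_seqs: "(\<And>M. M \<in> set Ms \<Longrightarrow> wf8 M) \<Longrightarrow> wf8 (seqs Ms)"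
  unfolding seqs_def by (induction Ms) (simp_all add: wf8_skip wf8_seq)

lemma wf8_cond:
  assumes "wf8 M\<^sub>1" "wf8 M\<^sub>2"
  shows "wf8 (cond c M\<^sub>1 M\<^sub>2)"
proof -
  have "fst (trans M\<^sub>1 q xs) \<le> num_states M\<^sub>1 + num_states M\<^sub>2"
    if "q < num_states M\<^sub>1" "length xs = 8" for q xs
    using wf8D(1)[OF assms(1) that] by simp
  then show ?thesis
    using assms[THEN wf8D(1)] assms[THEN wf8D(2)]
    unfolding wf8_iff cond_def Let_def by simp
qed

lemma wf8_while:
  assumes "wf8 M"
  shows "wf8 (while c M)"
  using assms[THEN wf8D(1)] assms[THEN wf8D(2)]
  unfolding wf8_iff while_def Let_def by simp

lemma runs_skip: "runs skip ts 0 ts"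
  by (simp add: runs_def skip_def)

lemma runs_act: "runs (act f) ts 1 (map2 act_tape (f (map read_tape ts)) ts)"
  by (simp add: runs_def act_def step_def)

text \<open>The first machine is embedded unchanged and the second with shifted states. The halting
  state of the first is the initial state of the second, so the times simply add up.\<close>

lemma runs_seq:
  assumes "runs M\<^sub>1 ts t ts'" "runs M\<^sub>2 ts' t' ts''"
  shows "runs (seq M\<^sub>1 M\<^sub>2) ts (t + t') ts''"
proof -
  have "\<exists>u \<le> t. (step (seq M\<^sub>1 M\<^sub>2) ^^ u) (id 0, ts) = (id (num_states M\<^sub>1), ts')"
    by (rule embedded_run) (use assms(1) in \<open>simp_all add: seq_def runs_def apfst_id[unfolded id_def]\<close>)
  then obtain u where u: "u \<le> t" "(step (seq M\<^sub>1 M\<^sub>2) ^^ u) (0, ts) = (num_states M\<^sub>1, ts')" by auto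
  have "\<exists>u' \<le> t'. (step (seq M\<^sub>1 M\<^sub>2) ^^ u') (num_states M\<^sub>1 + 0, ts') =
      (num_states M\<^sub>1 + num_states M\<^sub>2, ts'')"
    by (rule embedded_run) (use assms(2) in \<open>simp_all add: seq_def runs_def\<close>)
  then obtain u' where
    u': "u' \<le> t'" "(step (seq M\<^sub>1 M\<^sub>2) ^^ u') (num_states M\<^sub>1, ts') = (num_states (seq M\<^sub>1 M\<^sub>2), ts'')"
    by (auto simp: seq_def)
  show ?thesis using u u' by (intro runs_compose[OF u(2) u'(2)]) simp
qed

lemma runs_Nil: "runs (seqs []) ts 0 ts"
  by (simp add: seqs_def runs_skip)

lemma runs_Cons:
  "runs M ts t ts' \<Longrightarrow> runs (seqs Ms) ts' t' ts'' \<Longrightarrow> runs (seqs (M # Ms)) ts (t + t') ts''"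
  by (simp add: seqs_def runs_seq)

lemma act_tape_keep: "map2 act_tape (keep (map read_tape ts)) ts = ts"
  by (rule nth_equalityI) (simp_all add: act_tape_def read_tape_def)

text \<open>An action on one or two tapes is written as \<open>keep\<close> with some entries
  replaced; this lemma evaluates the replaced entries one by one, leaving the identity of
  \<open>act_tape_keep\<close>.\<close>

lemma act_tape_update:
  assumes "length as = length ts"
  shows "map2 act_tape (as[j := a]) ts = (map2 act_tape as ts)[j := act_tape a (ts ! j)]"
  using assms by (cases "j < length ts"; intro nth_equalityI) (simp_all add: nth_list_update)

lemma step_keep:
  assumes "q < num_states M" "trans M q (map read_tape ts) = (q', keep (map read_tape ts))"
  shows "(step M ^^ 1) (q, ts) = (q', ts)"
  using step_trans[OF assms] act_tape_keep[of ts] by simp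

lemma runs_cond_True:
  assumes "c (map read_tape ts)" "runs M\<^sub>1 ts t ts'"
  shows "runs (cond c M\<^sub>1 M\<^sub>2) ts (Suc t) ts'"
proof -
  let ?n = "Suc (num_states M\<^sub>1 + num_states M\<^sub>2)"
  let ?h = "\<lambda>q. if q = num_states M\<^sub>1 then ?n else Suc q"
  have 1: "(step (cond c M\<^sub>1 M\<^sub>2) ^^ 1) (0, ts) = (?h 0, ts)"
    by (rule step_keep) (use assms(1) in \<open>simp_all add: cond_def Let_def\<close>)
  have "\<exists>u \<le> t. (step (cond c M\<^sub>1 M\<^sub>2) ^^ u) (?h 0, ts) = (?h (num_states M\<^sub>1), ts')"
    by (rule embedded_run) (use assms(2) in \<open>simp_all add: cond_def Let_def runs_def\<close>)
  then obtain u where u: "u \<le> t"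
    "(step (cond c M\<^sub>1 M\<^sub>2) ^^ u) (?h 0, ts) = (num_states (cond c M\<^sub>1 M\<^sub>2), ts')"
    by (auto simp: cond_def Let_def)
  show ?thesis using u(1) by (intro runs_compose[OF 1 u(2)]) simp
qed

lemma runs_cond_False:
  assumes "\<not> c (map read_tape ts)" "runs M\<^sub>2 ts t ts'"
  shows "runs (cond c M\<^sub>1 M\<^sub>2) ts (Suc t) ts'"
proof -
  let ?h = "(+) (Suc (num_states M\<^sub>1))"
  have 1: "(step (cond c M\<^sub>1 M\<^sub>2) ^^ 1) (0, ts) = (?h 0, ts)"
    by (rule step_keep) (use assms(1) in \<open>simp_all add: cond_def Let_def\<close>)
  have "\<exists>u \<le> t. (step (cond c M\<^sub>1 M\<^sub>2) ^^ u) (?h 0, ts) = (?h (num_states M\<^sub>2), ts')"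
    by (rule embedded_run) (use assms(2) in \<open>simp_all add: cond_def Let_def runs_def\<close>)
  then obtain u where u: "u \<le> t"
    "(step (cond c M\<^sub>1 M\<^sub>2) ^^ u) (?h 0, ts) = (num_states (cond c M\<^sub>1 M\<^sub>2), ts')"
    by (auto simp: cond_def Let_def)
  show ?thesis using u(1) by (intro runs_compose[OF 1 u(2)]) simp
qed

lemma runs_while_False:
  assumes "\<not> c (map read_tape ts)"
  shows "runs (while c M) ts (Suc 0) ts"
proof -
  have "(step (while c M) ^^ 1) (0, ts) = (num_states (while c M), ts)"
    by (rule step_keep) (use assms in \<open>simp_all add: while_def Let_def\<close>)
  then show ?thesis by (simp add: runs_def)
qed

lemma runs_while_True:
  assumes "c (map read_tape ts)" "runs M ts t ts'" "runs (while c M) ts' t' ts''"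
  shows "runs (while c M) ts (Suc (t + t')) ts''"
proof -
  let ?h = "\<lambda>q. if q = num_states M then 0 else Suc q"
  have 1: "(step (while c M) ^^ 1) (0, ts) = (?h 0, ts)"
    by (rule step_keep) (use assms(1) in \<open>simp_all add: while_def Let_def\<close>)
  have "\<exists>u \<le> t. (step (while c M) ^^ u) (?h 0, ts) = (?h (num_states M), ts')"
    by (rule embedded_run) (use assms(2) in \<open>simp_all add: while_def Let_def runs_def\<close>)
  then obtain u where u: "u \<le> t" "(step (while c M) ^^ u) (?h 0, ts) = (0, ts')"
    by auto
  have "(step (while c M) ^^ (u + 1)) (0, ts) = (0, ts')"
    unfolding funpow_add o_apply 1 by (rule u(2))
  from this assms(3)[unfolded runs_def] show ?thesis
    by (rule runs_compose) (use u(1) in simp)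
qed

text \<open>A head moves at most one cell per step. Since the written words end at the heads of
  their tapes, this will bound the lengths of the collected lists by the running time, without
  computing them.\<close>

lemma runs_head_bound:
  assumes "runs M ts t ts'" "k < length ts'"
  shows "snd (ts' ! k) \<le> snd (ts ! k) + int t"
proof -
  \<comment> \<open>The claim on lengths is carried along because \<open>map2\<close> may truncate
    the list of tapes.\<close>
  have "k < length ts \<and> snd (ts' ! k) \<le> snd (ts ! k) + int t"
    if "(step M ^^ t) (q, ts) = (q', ts')" "k < length ts'" for q q'
    using that
  proof (induction t arbitrary: q' ts')
    case 0
    then show ?case by simp
  next
    case (Suc t)
    obtain p us where us: "(step M ^^ t) (q, ts) = (p, us)" by fastforce
    with Suc.prems have st: "step M (p, us) = (q', ts')" by simp
    show ?case
    proof (cases "p < num_states M")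
      case False
      with st Suc.IH[OF us] Suc.prems(2) show ?thesis by (auto simp: step_idle)
    next
      case True
      obtain r as where "trans M p (map read_tape us) = (r, as)" by fastforce
      from step_trans[OF True this] st have "ts' = map2 act_tape as us" by simp
      moreover have "shift (snd (as ! k)) \<le> 1" by (cases "snd (as ! k)") simp_all
      ultimately show ?thesis using Suc.IH[OF us] Suc.prems(2) by (auto simp: act_tape_def)
    qed
  qed
  with assms show ?thesis unfolding runs_def by blast
qed


section \<open>Elementary tape operations\<close>

definition upd :: "nat \<Rightarrow> (sym option \<Rightarrow> sym option \<times> move) \<Rightarrow> tm" where
  "upd j g = act (\<lambda>xs. (keep xs)[j := g (xs ! j)])"

definition transfer :: "nat \<Rightarrow> nat \<Rightarrow> tm" where
  "transfer j k = act (\<lambda>xs. (keep xs)[j := (xs ! j, MoveRight), k := (xs ! j, MoveRight)])"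

definition advance :: "nat \<Rightarrow> tm" where
  "advance j = upd j (\<lambda>x. (x, MoveRight))"

definition retreat :: "nat \<Rightarrow> tm" where
  "retreat j = upd j (\<lambda>x. (x, MoveLeft))"

definition emit :: "nat \<Rightarrow> sym list \<Rightarrow> tm" where
  "emit k w = seqs (map (\<lambda>a. upd k (\<lambda>_. (Some a, MoveRight))) w)"

text \<open>The head of tape \<open>j\<close> goes back to the blank before its word and then
  forward again during the transfer. It ends where it started, so the source is preserved and ready
  for further use.\<close>

definition copy :: "nat \<Rightarrow> nat \<Rightarrow> tm" where
  "copy j k = seqs [retreat j, while (\<lambda>xs. xs ! j \<noteq> None) (retreat j), advance j,
     while (\<lambda>xs. xs ! j \<noteq> None) (transfer j k)]"

definition clear :: "nat \<Rightarrow> tm" where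
  "clear j = seqs [retreat j, while (\<lambda>xs. xs ! j \<noteq> None) (upd j (\<lambda>_. (None, MoveLeft))), advance j]"

lemma wf8_upd: "wf8 (upd j g)"
  by (simp add: upd_def wf8_act)

lemma wf8_transfer: "wf8 (transfer j k)"
  by (simp add: transfer_def wf8_act)

lemma wf8_advance: "wf8 (advance j)"
  by (simp add: advance_def wf8_upd)

lemma wf8_retreat: "wf8 (retreat j)"
  by (simp add: retreat_def wf8_upd)

lemma wf8_emit: "wf8 (emit k w)"
  unfolding emit_def by (rule wf8_seqs) (auto simp: wf8_upd)

lemma wf8_copy: "wf8 (copy j k)"
  unfolding copy_def by (rule wf8_seqs) (auto simp: wf8_retreat wf8_advance wf8_while wf8_transfer)

lemma wf8_clear: "wf8 (clear j)"
  unfolding clear_def by (rule wf8_seqs) (auto simp: wf8_retreat wf8_advance wf8_while wf8_upd)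

definition tape_end :: "sym list \<Rightarrow> tape" where
  "tape_end w = (word_cells w, int (length w))"

lemma runs_upd:
  assumes "j < length ts"
  shows "runs (upd j g) ts 1 (ts[j := act_tape (g (read_tape (ts ! j))) (ts ! j)])"
proof -
  have "map2 act_tape ((keep (map read_tape ts))[j := g (map read_tape ts ! j)]) ts =
      ts[j := act_tape (g (read_tape (ts ! j))) (ts ! j)]"
    by (subst act_tape_update) (use assms in \<open>simp_all only: act_tape_keep nth_map length_map\<close>)
  with runs_act[of "\<lambda>xs. (keep xs)[j := g (xs ! j)]" ts] show ?thesis
    unfolding upd_def by simp
qed

lemma runs_advance:
  assumes "j < length ts"
  shows "runs (advance j) ts 1 (ts[j := (fst (ts ! j), snd (ts ! j) + 1)])"
  using runs_upd[OF assms, of "\<lambda>x. (x, MoveRight)"]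
  by (simp add: advance_def act_tape_def read_tape_def)

lemma runs_retreat:
  assumes "j < length ts"
  shows "runs (retreat j) ts 1 (ts[j := (fst (ts ! j), snd (ts ! j) - 1)])"
  using runs_upd[OF assms, of "\<lambda>x. (x, MoveLeft)"]
  by (simp add: retreat_def act_tape_def read_tape_def)

lemma runs_transfer:
  assumes "j < length ts" "k < length ts" "j \<noteq> k"
  shows "runs (transfer j k) ts 1 (ts[j := (fst (ts ! j), snd (ts ! j) + 1),
    k := act_tape (read_tape (ts ! j), MoveRight) (ts ! k)])"
proof -
  have "map2 act_tape ((keep (map read_tape ts))[j := (map read_tape ts ! j, MoveRight),
        k := (map read_tape ts ! j, MoveRight)]) ts =
      ts[j := act_tape (read_tape (ts ! j), MoveRight) (ts ! j),
        k := act_tape (read_tape (ts ! j), MoveRight) (ts ! k)]"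
    by (subst act_tape_update, simp, subst act_tape_update)
      (use assms in \<open>simp_all only: act_tape_keep nth_map length_map\<close>)
  moreover have "act_tape (read_tape (ts ! j), MoveRight) (ts ! j) =
      (fst (ts ! j), snd (ts ! j) + 1)"
    by (simp add: act_tape_def read_tape_def)
  ultimately show ?thesis
    using runs_act[of "\<lambda>xs. (keep xs)[j := (xs ! j, MoveRight), k := (xs ! j, MoveRight)]" ts]
    unfolding transfer_def by simp
qed

lemma word_cells_at [simp]: "p < length w \<Longrightarrow> word_cells w (int p) = Some (w ! p)"
  by (simp add: word_cells_def)

lemma word_cells_outside [simp]:
  "word_cells w (int (length w)) = None" "word_cells w (- 1) = None"
  by (simp_all add: word_cells_def)

lemma word_cells_snoc: "(word_cells w)(int (length w) := Some a) = word_cells (w @ [a])"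
  by (auto simp: word_cells_def nth_append fun_eq_iff)

lemma word_cells_butlast: "(word_cells (w @ [a]))(int (length w) := None) = word_cells w"
  by (auto simp: word_cells_def nth_append fun_eq_iff)

lemma act_tape_end: "act_tape (Some a, MoveRight) (tape_end w) = tape_end (w @ [a])"
  by (simp add: act_tape_def tape_end_def word_cells_snoc)

lemma runs_emit:
  assumes "k < length ts" "ts ! k = tape_end u"
  shows "runs (emit k w) ts (length w) (ts[k := tape_end (u @ w)])"
  using assms
proof (induction w arbitrary: ts u)
  case Nil
  then show ?case using list_update_id[of ts k] by (simp add: emit_def runs_Nil)
next
  case (Cons a w)
  let ?ts = "ts[k := tape_end (u @ [a])]"
  have "runs (upd k (\<lambda>_. (Some a, MoveRight))) ts 1 ?ts"
    using runs_upd[OF Cons.prems(1), of "\<lambda>_. (Some a, MoveRight)"] Cons.prems(2)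
    by (simp add: act_tape_end)
  moreover have "runs (emit k w) ?ts (length w) (?ts[k := tape_end ((u @ [a]) @ w)])"
    by (rule Cons.IH) (use Cons.prems in simp_all)
  ultimately have "runs (emit k (a # w)) ts (1 + length w) (?ts[k := tape_end ((u @ [a]) @ w)])"
    unfolding emit_def list.map by (rule runs_Cons)
  then show ?case by simp
qed

text \<open>Here \<open>p\<close> counts the letters still to be crossed; for \<open>p = 0\<close>
  the head is on the blank left of the word. Each letter costs a test and a move, and the last test
  one more step.\<close>

lemma runs_rewind:
  assumes "j < length ts" "p \<le> length w"
  shows "runs (while (\<lambda>xs. xs ! j \<noteq> None) (retreat j)) (ts[j := (word_cells w, int p - 1)])
    (2 * p + 1) (ts[j := (word_cells w, - 1)])"
  using assms(2)
proof (induction p)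
  case 0
  then show ?case using assms(1) by (auto intro!: runs_while_False simp: read_tape_def)
next
  case (Suc p)
  let ?ts = "ts[j := (word_cells w, int (Suc p) - 1)]"
  have "runs (retreat j) ?ts 1 (ts[j := (word_cells w, int p - 1)])"
    using runs_retreat[of j ?ts] assms(1) by simp
  moreover have "map read_tape ?ts ! j \<noteq> None"
    using assms(1) Suc.prems by (simp add: read_tape_def)
  ultimately have "runs (while (\<lambda>xs. xs ! j \<noteq> None) (retreat j)) ?ts (Suc (1 + (2 * p + 1)))
      (ts[j := (word_cells w, - 1)])"
    using Suc by (intro runs_while_True) simp_all
  then show ?case by simp
qed

lemma runs_erase:
  assumes "j < length ts"
  shows "runs (while (\<lambda>xs. xs ! j \<noteq> None) (upd j (\<lambda>_. (None, MoveLeft))))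
    (ts[j := (word_cells w, int (length w) - 1)]) (2 * length w + 1) (ts[j := (word_cells [], - 1)])"
proof (induction w rule: rev_induct)
  case Nil
  then show ?case using assms(1) by (auto intro!: runs_while_False simp: read_tape_def)
next
  case (snoc a w)
  let ?ts = "ts[j := (word_cells (w @ [a]), int (length w))]"
  have "runs (upd j (\<lambda>_. (None, MoveLeft))) ?ts 1 (ts[j := (word_cells w, int (length w) - 1)])"
    using runs_upd[of j ?ts "\<lambda>_. (None, MoveLeft)"] assms(1)
    by (simp add: act_tape_def word_cells_butlast)
  moreover have "map read_tape ?ts ! j \<noteq> None"
    using assms(1) by (simp add: read_tape_def)
  ultimately have "runs (while (\<lambda>xs. xs ! j \<noteq> None) (upd j (\<lambda>_. (None, MoveLeft)))) ?ts
      (Suc (1 + (2 * length w + 1))) (ts[j := (word_cells [], - 1)])"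
    using snoc by (intro runs_while_True) simp_all
  then show ?case by simp
qed

text \<open>Copying stops at the first symbol after \<open>y\<close>, which is the head of
  \<open>z\<close> or a blank. This serves both \<open>copy\<close>, which stops at the blank, and
  the reading of a name, which stops at \<open>Close\<close>.\<close>

lemma runs_while_transfer:
  assumes "j < length ts" "k < length ts" "j \<noteq> k"
    and "\<And>xs. length xs = length ts \<Longrightarrow> c xs \<longleftrightarrow> P (xs ! j)"
    and "\<forall>a \<in> set y. P (Some a)" "\<not> P (case z of [] \<Rightarrow> None | a # _ \<Rightarrow> Some a)"
  shows "runs (while c (transfer j k))
    (ts[j := (word_cells (x @ y @ z), int (length x)), k := tape_end u]) (2 * length y + 1)
    (ts[j := (word_cells (x @ y @ z), int (length (x @ y))), k := tape_end (u @ y)])"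
  using assms(5)
proof (induction y arbitrary: x u)
  case Nil
  have "word_cells (x @ z) (int (length x)) = (case z of [] \<Rightarrow> None | a # _ \<Rightarrow> Some a)"
    by (cases z) simp_all
  with assms show ?case by (auto intro!: runs_while_False simp: read_tape_def)
next
  case (Cons a y)
  let ?w = "x @ (a # y) @ z"
  let ?ts = "ts[j := (word_cells ?w, int (length x)), k := tape_end u]"
  let ?us = "ts[j := (word_cells ?w, int (length (x @ [a]))), k := tape_end (u @ [a])]"
  have tape: "?ts ! j = (word_cells ?w, int (length x))" "?ts ! k = tape_end u"
    using assms by simp_all
  have read: "read_tape (?ts ! j) = Some a"
    unfolding tape by (simp add: read_tape_def)
  have "runs (transfer j k) ?ts 1 ?us"
    using runs_transfer[of j ?ts k] assms(1-3) unfolding read unfolding tape act_tape_end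
    by (simp add: list_update_swap[of k j] add.commute)
  moreover have "c (map read_tape ?ts)"
    using assms read Cons.prems by simp
  moreover have "runs (while c (transfer j k)) ?us (2 * length y + 1)
      (ts[j := (word_cells ?w, int (length (x @ a # y))), k := tape_end (u @ a # y)])"
    using Cons.IH[of "x @ [a]" "u @ [a]"] Cons.prems by simp
  ultimately have "runs (while c (transfer j k)) ?ts (Suc (1 + (2 * length y + 1)))
      (ts[j := (word_cells ?w, int (length (x @ a # y))), k := tape_end (u @ a # y)])"
    by - (rule runs_while_True)
  then show ?case by simp
qed

lemma runs_copy:
  assumes "j < length ts" "k < length ts" "j \<noteq> k" "ts ! j = tape_end w" "ts ! k = tape_end u"
  shows "runs (copy j k) ts (4 * length w + 4) (ts[k := tape_end (u @ w)])"
proof -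
  let ?c = "\<lambda>xs :: sym option list. xs ! j \<noteq> None"
  let ?us = "ts[j := (word_cells w, - 1)]"
  have j: "ts[j := tape_end w] = ts" "ts[j := (word_cells w, 0)] = ts[j := (word_cells w, 0), k := tape_end u]"
    using assms list_update_id[of ts j] list_update_id[of "ts[j := (word_cells w, 0)]" k] by simp_all
  have "runs (retreat j) ts 1 (ts[j := (word_cells w, int (length w) - 1)])"
    using runs_retreat[OF assms(1)] assms(4) by (simp add: tape_end_def)
  moreover have "runs (while ?c (retreat j)) (ts[j := (word_cells w, int (length w) - 1)])
      (2 * length w + 1) ?us"
    by (rule runs_rewind[OF assms(1) order_refl])
  moreover have "runs (advance j) ?us 1 (ts[j := (word_cells w, 0), k := tape_end u])"
    using runs_advance[of j ?us] assms(1) by (simp flip: j(2))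
  moreover have "runs (while ?c (transfer j k)) (ts[j := (word_cells w, 0), k := tape_end u])
      (2 * length w + 1) (ts[k := tape_end (u @ w)])"
    using runs_while_transfer[OF assms(1-3), of ?c "\<lambda>x. x \<noteq> None" w "[]" "[]" u] j(1)
    by (simp add: tape_end_def)
  ultimately have "runs (copy j k) ts (1 + ((2 * length w + 1) + (1 + ((2 * length w + 1) + 0))))
      (ts[k := tape_end (u @ w)])"
    unfolding copy_def by - (intro runs_Cons; (assumption | rule runs_Nil))
  then show ?thesis by (rule runs_mono) simp
qed

lemma runs_clear:
  assumes "j < length ts" "ts ! j = tape_end w"
  shows "runs (clear j) ts (2 * length w + 3) (ts[j := tape_end []])"
proof -
  let ?us = "ts[j := (word_cells [], - 1)]"
  have "runs (retreat j) ts 1 (ts[j := (word_cells w, int (length w) - 1)])"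
    using runs_retreat[OF assms(1)] assms(2) by (simp add: tape_end_def)
  moreover note runs_erase[OF assms(1), of w]
  moreover have "runs (advance j) ?us 1 (ts[j := tape_end []])"
    using runs_advance[of j ?us] assms(1) by (simp add: tape_end_def)
  ultimately have "runs (clear j) ts (1 + ((2 * length w + 1) + (1 + 0))) (ts[j := tape_end []])"
    unfolding clear_def by - (intro runs_Cons; (assumption | rule runs_Nil))
  then show ?thesis by (rule runs_mono) simp
qed


section \<open>The machine\<close>

text \<open>
  Tape \<open>0\<close> holds the input. Tape \<open>k + 1\<close> holds the word \<open>ws k\<close>, with the head at its right end:
  unary counters of the clauses (\<open>k = 0\<close>) and of the literals read so far (\<open>k = 1\<close>), the variable
  of the current literal (\<open>k = 2\<close>), the lists of OR nodes (\<open>k = 3\<close>), AND nodes (\<open>k = 4\<close>) and edges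
  (\<open>k = 5\<close>) collected so far, and the output (\<open>k = 6\<close>).
\<close>

definition conf :: "sym list \<Rightarrow> sym list \<Rightarrow> (nat \<Rightarrow> sym list) \<Rightarrow> tape list" where
  "conf pre suf ws =
     (word_cells (pre @ suf), int (length pre)) # map (\<lambda>k. tape_end (ws k)) [0..<7]"

lemma length_conf [simp]: "length (conf pre suf ws) = 8"
  by (simp add: conf_def)

lemma conf_nth [simp]:
  "k < 7 \<Longrightarrow> conf pre suf ws ! Suc k = tape_end (ws k)"
  "conf pre suf ws ! 0 = (word_cells (pre @ suf), int (length pre))"
  by (simp_all add: conf_def)

lemma conf_update:
  "k < 7 \<Longrightarrow> (conf pre suf ws)[Suc k := tape_end w] = conf pre suf (ws(k := w))"
  by (rule nth_equalityI) (auto simp: conf_def nth_list_update nth_Cons split: nat.splits)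

lemma read_input:
  "map read_tape (conf pre suf ws) ! 0 = (case suf of [] \<Rightarrow> None | a # _ \<Rightarrow> Some a)"
proof (cases suf)
  case (Cons a suf')
  then show ?thesis
    using word_cells_at[of "length pre" "pre @ suf"] by (simp add: conf_def read_tape_def)
qed (simp add: conf_def read_tape_def)

lemma emit_conf:
  assumes "k < 7"
  shows "runs (emit (Suc k) w) (conf pre suf ws) (length w) (conf pre suf (ws(k := ws k @ w)))"
  using runs_emit[of "Suc k" "conf pre suf ws" "ws k" w] assms by (simp add: conf_update)

lemma copy_conf:
  assumes "j < 7" "k < 7" "j \<noteq> k"
  shows "runs (copy (Suc j) (Suc k)) (conf pre suf ws) (4 * length (ws j) + 4)
    (conf pre suf (ws(k := ws k @ ws j)))"
  using runs_copy[of "Suc j" "conf pre suf ws" "Suc k" "ws j" "ws k"] assms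
  by (simp add: conf_update)

lemma clear_conf:
  assumes "k < 7"
  shows "runs (clear (Suc k)) (conf pre suf ws) (2 * length (ws k) + 3) (conf pre suf (ws(k := [])))"
  using runs_clear[of "Suc k" "conf pre suf ws" "ws k"] assms by (simp add: conf_update)

lemma advance_conf: "runs (advance 0) (conf pre (a # suf) ws) 1 (conf (pre @ [a]) suf ws)"
proof -
  have "(conf pre (a # suf) ws)[0 := (word_cells (pre @ a # suf), int (length pre) + 1)] =
      conf (pre @ [a]) suf ws"
    by (simp add: conf_def)
  with runs_advance[of 0 "conf pre (a # suf) ws"] show ?thesis by simp
qed

abbreviation reads_bit :: "sym option list \<Rightarrow> bool" where
  "reads_bit xs \<equiv> xs ! 0 \<in> range (Some \<circ> Bit)"

lemma read_name_conf:
  "runs (while reads_bit (transfer 0 3)) (conf pre (map Bit v @ Close # suf) ws) (2 * length v + 1)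
    (conf (pre @ map Bit v) (Close # suf) (ws(2 := ws 2 @ map Bit v)))"
proof -
  let ?ts = "conf pre (map Bit v @ Close # suf) ws"
  \<comment> \<open>Tape \<open>3\<close> is word \<open>2\<close>, because tape \<open>0\<close> is
    the input.\<close>
  have upd: "(conf pre' suf' ws)[3 := tape_end w] = conf pre' suf' (ws(2 := w))" for pre' suf' w
    using conf_update[of 2] by simp
  have "?ts[0 := (word_cells (pre @ map Bit v @ Close # suf), int (length pre))] = ?ts"
    by (simp add: conf_def)
  then have "?ts[0 := (word_cells (pre @ map Bit v @ Close # suf), int (length pre)),
      3 := tape_end (ws 2)] = ?ts"
    by (simp only: upd fun_upd_triv)
  moreover have "?ts[0 := (word_cells (pre @ map Bit v @ Close # suf), int (length (pre @ map Bit v)))] =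
      conf (pre @ map Bit v) (Close # suf) ws"
    by (simp add: conf_def)
  then have "?ts[0 := (word_cells (pre @ map Bit v @ Close # suf), int (length (pre @ map Bit v))),
      3 := tape_end (ws 2 @ map Bit v)] =
      conf (pre @ map Bit v) (Close # suf) (ws(2 := ws 2 @ map Bit v))"
    by (simp only: upd)
  moreover have "runs (while reads_bit (transfer 0 3))
    (?ts[0 := (word_cells (pre @ map Bit v @ Close # suf), int (length pre)), 3 := tape_end (ws 2)])
    (2 * length (map Bit v) + 1)
    (?ts[0 := (word_cells (pre @ map Bit v @ Close # suf), int (length (pre @ map Bit v))),
      3 := tape_end (ws 2 @ map Bit v)])"
    by (rule runs_while_transfer[where P = "\<lambda>x. x \<in> range (Some \<circ> Bit)"]) auto
  ultimately show ?thesis by (simp only: length_map)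
qed

lemma enc_name_eq: "enc_name v = Open # map Bit v @ [Close]"
proof -
  have "concat (map enc_bool v) = map Bit v" by (induction v) (simp_all add: enc_bool_def)
  then show ?thesis by (simp add: enc_list_def)
qed


subsection \<open>Writing nodes and edges\<close>

text \<open>
  A template \<open>(w, s)\<close> describes the node whose name is the constant \<open>w\<close> followed by the current
  contents of the register \<open>s\<close>, one of the words \<open>0, 1, 2\<close> above.
\<close>

type_synonym template = "name \<times> nat option"

fun inst :: "(nat \<Rightarrow> name) \<Rightarrow> template \<Rightarrow> name" where
  "inst r (w, None) = w"
| "inst r (w, Some j) = w @ r j"

text \<open>No constant prefix in use is longer than three bits; fixing this limit gives one time
  bound for all templates.\<close>

fun valid :: "template \<Rightarrow> bool" where
  "valid (w, s) \<longleftrightarrow> length w \<le> 3 \<and> (\<forall>j \<in> set_option s. j < 3)"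

text \<open>\<open>L\<close> bounds all registers at once, so that times depend on \<open>L\<close>
  only. Words from index \<open>3\<close> on are exempt, hence writing to the lists preserves the
  condition.\<close>

definition regs :: "(nat \<Rightarrow> name) \<Rightarrow> nat \<Rightarrow> (nat \<Rightarrow> sym list) \<Rightarrow> bool" where
  "regs r L ws \<longleftrightarrow> (\<forall>j < 3. ws j = map Bit (r j) \<and> length (r j) \<le> L)"

lemma regs_update: "regs r L ws \<Longrightarrow> 3 \<le> k \<Longrightarrow> regs r L (ws(k := w))"
  by (simp add: regs_def)

fun emit_name :: "nat \<Rightarrow> template \<Rightarrow> tm" where
  "emit_name k (w, None) = emit (Suc k) (enc_name w)"
| "emit_name k (w, Some j) =
     seqs [emit (Suc k) (Open # map Bit w), copy (Suc j) (Suc k), emit (Suc k) [Close]]"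

fun emit_edge :: "nat \<Rightarrow> template \<times> template \<Rightarrow> tm" where
  "emit_edge k (a, b) = seqs [emit (Suc k) [Open], emit_name k a, emit_name k b, emit (Suc k) [Close]]"

lemma wf8_emit_name: "wf8 (emit_name k t)"
  by (cases "(k, t)" rule: emit_name.cases) (auto simp: wf8_emit wf8_copy intro!: wf8_seqs)

lemma wf8_emit_edge: "wf8 (emit_edge k t)"
  by (cases t) (auto simp: wf8_emit wf8_emit_name intro!: wf8_seqs)

text \<open>At most four symbols for \<open>Open\<close> and the prefix, \<open>4 * L + 4\<close>
  steps for copying the register, and one for \<open>Close\<close>.\<close>

lemma runs_emit_name:
  assumes "3 \<le> k" "k < 7" "valid t" "regs r L ws"
  shows "runs (emit_name k t) (conf pre suf ws) (4 * L + 9)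
    (conf pre suf (ws(k := ws k @ enc_name (inst r t))))"
proof (cases "(k, t)" rule: emit_name.cases)
  case (1 k' w)
  with assms(3) have "length (enc_name w) \<le> 4 * L + 9" by (simp add: enc_name_eq)
  from runs_mono[OF emit_conf[OF assms(2)] this] 1 show ?thesis by simp
next
  case (2 k' w j)
  then have t: "t = (w, Some j)" by simp
  with assms have j: "j < 7" "j \<noteq> k" "ws j = map Bit (r j)" "length (r j) \<le> L" and w: "length w \<le> 3"
    by (simp_all add: regs_def)
  let ?ws1 = "ws(k := ws k @ Open # map Bit w)"
  let ?ws2 = "?ws1(k := ?ws1 k @ ?ws1 j)"
  have "runs (emit_name k t) (conf pre suf ws) (length (Open # map Bit w) +
      ((4 * length (?ws1 j) + 4) + (length [Close] + 0))) (conf pre suf (?ws2(k := ?ws2 k @ [Close])))"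
    unfolding t emit_name.simps
    by (rule runs_Cons runs_Nil emit_conf copy_conf j assms(2))+
  moreover have "?ws2(k := ?ws2 k @ [Close]) = ws(k := ws k @ enc_name (inst r t))"
    using t j by (simp add: enc_name_eq)
  ultimately show ?thesis
    using j w by (auto elim: runs_mono)
qed

lemma runs_emit_edge:
  assumes "3 \<le> k" "k < 7" "valid a" "valid b" "regs r L ws"
  shows "runs (emit_edge k (a, b)) (conf pre suf ws) (8 * L + 20)
    (conf pre suf (ws(k := ws k @ enc_prod enc_name enc_name (inst r a, inst r b))))"
proof -
  let ?ws1 = "ws(k := ws k @ [Open])"
  let ?ws2 = "?ws1(k := ?ws1 k @ enc_name (inst r a))"
  let ?ws3 = "?ws2(k := ?ws2 k @ enc_name (inst r b))"
  have "regs r L ?ws1" "regs r L ?ws2"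
    using assms by (intro regs_update; simp)+
  then have "runs (emit_edge k (a, b)) (conf pre suf ws) (length [Open] + ((4 * L + 9) +
      ((4 * L + 9) + (length [Close] + 0)))) (conf pre suf (?ws3(k := ?ws3 k @ [Close])))"
    unfolding emit_edge.simps by - (rule runs_Cons runs_Nil emit_conf runs_emit_name assms | assumption)+
  moreover have "?ws3(k := ?ws3 k @ [Close]) =
      ws(k := ws k @ enc_prod enc_name enc_name (inst r a, inst r b))"
    by (simp add: enc_prod_def)
  ultimately show ?thesis by (auto elim: runs_mono)
qed

lemma runs_emit_all:
  assumes "3 \<le> k" "regs r L ws"
    and "\<And>x ws. x \<in> set xs \<Longrightarrow> regs r L ws \<Longrightarrow>
      runs (f x) (conf pre suf ws) t (conf pre suf (ws(k := ws k @ e x)))"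
  shows "runs (seqs (map f xs)) (conf pre suf ws) (length xs * t)
    (conf pre suf (ws(k := ws k @ concat (map e xs))))"
  using assms(2,3)
proof (induction xs arbitrary: ws)
  case Nil
  then show ?case by (simp add: runs_Nil)
next
  case (Cons x xs)
  let ?ws = "ws(k := ws k @ e x)"
  have "runs (f x) (conf pre suf ws) t (conf pre suf ?ws)"
    by (rule Cons.prems(2)) (simp_all add: Cons.prems(1))
  moreover have "runs (seqs (map f xs)) (conf pre suf ?ws) (length xs * t)
      (conf pre suf (?ws(k := ?ws k @ concat (map e xs))))"
    by (rule Cons.IH, rule regs_update[OF Cons.prems(1) assms(1)])
      (rule Cons.prems(2), simp_all)
  ultimately have "runs (seqs (f x # map f xs)) (conf pre suf ws) (t + length xs * t)
      (conf pre suf (?ws(k := ?ws k @ concat (map e xs))))"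
    by (rule runs_Cons)
  then show ?case
    by (simp only: fun_upd_upd fun_upd_same list.map concat.simps append_assoc length_Cons mult_Suc)
qed

abbreviation enc_names :: "name list \<Rightarrow> sym list" where
  "enc_names xs \<equiv> concat (map enc_name xs)"

abbreviation enc_edges :: "(name \<times> name) list \<Rightarrow> sym list" where
  "enc_edges xs \<equiv> concat (map (enc_prod enc_name enc_name) xs)"

lemma runs_emit_names:
  assumes "3 \<le> k" "k < 7" "regs r L ws" "\<forall>t \<in> set xs. valid t" "map (inst r) xs = ys"
  shows "runs (seqs (map (emit_name k) xs)) (conf pre suf ws) (length xs * (4 * L + 9))
    (conf pre suf (ws(k := ws k @ enc_names ys)))"
proof -
  have "runs (seqs (map (emit_name k) xs)) (conf pre suf ws) (length xs * (4 * L + 9))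
      (conf pre suf (ws(k := ws k @ concat (map (\<lambda>t. enc_name (inst r t)) xs))))"
    by (rule runs_emit_all[OF assms(1,3)], rule runs_emit_name[OF assms(1,2)]) (use assms(4) in auto)
  then show ?thesis by (simp flip: assms(5) add: comp_def)
qed

lemma runs_emit_edges:
  assumes "3 \<le> k" "k < 7" "regs r L ws" "\<forall>(a, b) \<in> set xs. valid a \<and> valid b"
    "map (map_prod (inst r) (inst r)) xs = ys"
  shows "runs (seqs (map (emit_edge k) xs)) (conf pre suf ws) (length xs * (8 * L + 20))
    (conf pre suf (ws(k := ws k @ enc_edges ys)))"
proof -
  have "runs (seqs (map (emit_edge k) xs)) (conf pre suf ws) (length xs * (8 * L + 20))
      (conf pre suf (ws(k := ws k @
        concat (map (\<lambda>t. enc_prod enc_name enc_name (map_prod (inst r) (inst r) t)) xs))))"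
  proof (rule runs_emit_all[OF assms(1,3)])
    fix x ws' assume "x \<in> set xs" "regs r L ws'"
    with assms(1,2,4) show "runs (emit_edge k x) (conf pre suf ws') (8 * L + 20)
        (conf pre suf (ws'(k := ws' k @ enc_prod enc_name enc_name (map_prod (inst r) (inst r) x))))"
      using runs_emit_edge[OF assms(1,2) _ _ \<open>regs r L ws'\<close>, of "fst x" "snd x" pre suf]
      by (cases x) (auto simp del: emit_edge.simps fun_upd_apply)
  qed
  then show ?thesis by (simp flip: assms(5) add: comp_def)
qed


subsection \<open>Reading the formula\<close>

abbreviation clause_tmpl :: template where "clause_tmpl \<equiv> ([True, True], Some 0)"
abbreviation leaf_tmpl :: "bool \<Rightarrow> template" where "leaf_tmpl b \<equiv> ([True, False, b], Some 1)"
abbreviation var_tmpl :: template where "var_tmpl \<equiv> ([False, False], Some 2)"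
abbreviation sign_tmpl :: "bool \<Rightarrow> template" where "sign_tmpl b \<equiv> ([False, True, b], Some 2)"
abbreviation root_tmpl :: template where "root_tmpl \<equiv> (root_node, None)"
abbreviation bot_tmpl :: template where "bot_tmpl \<equiv> (bot_node, None)"

text \<open>The variable is erased and the occurrence counter advanced only after all templates have
  been instantiated.\<close>

definition write_lit :: "bool \<Rightarrow> tm" where
  "write_lit s = seqs
     [seqs (map (emit_name 3) [var_tmpl, leaf_tmpl True, leaf_tmpl False]),
      seqs (map (emit_name 4) [sign_tmpl True, sign_tmpl False]),
      seqs (map (emit_edge 5)
        [(root_tmpl, var_tmpl), (var_tmpl, sign_tmpl True), (var_tmpl, sign_tmpl False),
         (sign_tmpl True, leaf_tmpl True), (sign_tmpl False, leaf_tmpl False),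
         (clause_tmpl, leaf_tmpl s)]),
      clear (Suc 2), emit (Suc 1) [Bit True]]"

text \<open>The head starts on the sign bit. The first two moves skip it and the \<open>Open\<close>
  of the name, the last two the \<open>Close\<close> of the name and that of the literal.\<close>

definition read_name :: tm where
  "read_name = seqs [advance 0, advance 0, while reads_bit (transfer 0 3), advance 0, advance 0]"

text \<open>The sign is remembered in the control: the machine branches on it into two copies of the
  remaining program.\<close>

definition lit :: tm where
  "lit = seqs [advance 0, cond (\<lambda>xs. xs ! 0 = Some (Bit True))
     (seqs [read_name, write_lit True]) (seqs [read_name, write_lit False])]"

abbreviation reads_open :: "sym option list \<Rightarrow> bool" where
  "reads_open xs \<equiv> xs ! 0 = Some Open"

text \<open>One symbol of lookahead steers the loop: \<open>Open\<close> announces another literal,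
  \<open>Close\<close> ends the clause.\<close>

definition clause :: tm where
  "clause = seqs [advance 0, seqs (map (emit_name 3) [clause_tmpl]),
     seqs (map (emit_edge 5) [(root_tmpl, clause_tmpl), (clause_tmpl, bot_tmpl)]),
     while reads_open lit, advance 0, emit (Suc 0) [Bit True]]"

lemma wf8_write_lit: "wf8 (write_lit s)"
  unfolding write_lit_def
  by (rule wf8_seqs) (auto simp: wf8_clear wf8_emit wf8_emit_name wf8_emit_edge
      simp del: emit_name.simps emit_edge.simps intro!: wf8_seqs)

lemma wf8_read_name: "wf8 read_name"
  unfolding read_name_def by (rule wf8_seqs) (auto simp: wf8_advance wf8_while wf8_transfer)

lemma wf8_lit: "wf8 lit"
  unfolding lit_def
  by (rule wf8_seqs) (auto simp: wf8_advance wf8_read_name wf8_write_lit intro!: wf8_cond wf8_seqs)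

lemma wf8_clause: "wf8 clause"
  unfolding clause_def
  by (rule wf8_seqs) (auto simp: wf8_advance wf8_while wf8_lit wf8_emit wf8_emit_name wf8_emit_edge
      simp del: emit_name.simps emit_edge.simps intro!: wf8_seqs)

section \<open>Tape contents during the pass and running times of its stages\<close>

definition words :: "nat \<Rightarrow> nat \<Rightarrow> name \<Rightarrow> sym list \<Rightarrow> sym list \<Rightarrow> sym list \<Rightarrow> nat \<Rightarrow> sym list" where
  "words c i v A B E = (\<lambda>_. [])(0 := map Bit (replicate c True), 1 := map Bit (replicate i True),
     2 := map Bit v, 3 := A, 4 := B, 5 := E)"

definition contents :: "nat \<Rightarrow> nat \<Rightarrow> name \<Rightarrow> nat \<Rightarrow> name" where
  "contents c i v = (\<lambda>_. [])(0 := replicate c True, 1 := replicate i True, 2 := v)"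

lemma words_simps [simp]:
  "words c i v A B E 0 = map Bit (replicate c True)"
  "words c i v A B E (Suc 0) = map Bit (replicate i True)"
  "words c i v A B E 2 = map Bit v"
  "words c i v A B E 3 = A"
  "words c i v A B E 4 = B"
  "words c i v A B E 5 = E"
  "words c i v A B E 6 = []"
  by (simp_all add: words_def)

lemma words_update:
  "(words c i v A B E)(0 := map Bit (replicate c True) @ [Bit True]) = words (Suc c) i v A B E"
  "(words c i v A B E)(1 := map Bit (replicate i True) @ [Bit True]) = words c (Suc i) v A B E"
  "(words c i v A B E)(2 := map Bit w) = words c i w A B E"
  "(words c i v A B E)(2 := []) = words c i [] A B E"
  "(words c i v A B E)(3 := W) = words c i v W B E"
  "(words c i v A B E)(4 := W) = words c i v A W E"
  "(words c i v A B E)(5 := W) = words c i v A B W"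
  by (auto simp: words_def fun_eq_iff simp flip: replicate_append_same)

lemma contents_simps [simp]:
  "contents c i v 0 = replicate c True"
  "contents c i v (Suc 0) = replicate i True"
  "contents c i v 2 = v"
  by (simp_all add: contents_def)

lemma regs_words:
  assumes "c \<le> L" "i \<le> L" "length v \<le> L"
  shows "regs (contents c i v) L (words c i v A B E)"
  unfolding regs_def
proof (intro allI impI)
  fix j :: nat assume "j < 3"
  then consider "j = 0" | "j = Suc 0" | "j = 2" by linarith
  then show "words c i v A B E j = map Bit (contents c i v j) \<and> length (contents c i v j) \<le> L"
    by cases (use assms in simp_all)
qed

abbreviation enc_lit :: "literal \<Rightarrow> sym list" where
  "enc_lit \<equiv> enc_prod enc_bool enc_name"

abbreviation enc_clause :: "literal list \<Rightarrow> sym list" where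
  "enc_clause \<equiv> enc_list enc_lit"

lemma enc_lit_eq: "enc_lit (s, v) = Open # Bit s # Open # map Bit v @ [Close, Close]"
  by (simp add: enc_prod_def enc_bool_def enc_name_eq)

text \<open>The bound sums five names at \<open>4 * L + 9\<close>, six edges at
  \<open>8 * L + 20\<close>, at most \<open>2 * L + 3\<close> for erasing the variable, and one step
  for the counter.\<close>

lemma runs_write_lit:
  assumes "c \<le> L" "i \<le> L" "length v \<le> L"
  shows "runs (write_lit s) (conf pre suf (words c i v A B E)) (70 * L + 169)
    (conf pre suf (words c (Suc i) [] (A @ enc_names (lit_ors c i (s, v)))
      (B @ enc_names (lit_ands c i (s, v))) (E @ enc_edges (lit_edges c i (s, v)))))"
proof -
  let ?r = "contents c i v"
  let ?A = "A @ enc_names (lit_ors c i (s, v))"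
  let ?B = "B @ enc_names (lit_ands c i (s, v))"
  let ?E = "E @ enc_edges (lit_edges c i (s, v))"
  note regs = regs_words[OF assms]
  have 1: "runs (seqs (map (emit_name 3) [var_tmpl, leaf_tmpl True, leaf_tmpl False]))
      (conf pre suf (words c i v A B E)) (3 * (4 * L + 9)) (conf pre suf (words c i v ?A B E))"
    using runs_emit_names[OF _ _ regs, where k = 3 and pre = pre and suf = suf and
        xs = "[var_tmpl, leaf_tmpl True, leaf_tmpl False]" and ys = "lit_ors c i (s, v)"]
    by (simp add: words_update del: emit_name.simps fun_upd_apply)
  have 2: "runs (seqs (map (emit_name 4) [sign_tmpl True, sign_tmpl False]))
      (conf pre suf (words c i v ?A B E)) (2 * (4 * L + 9)) (conf pre suf (words c i v ?A ?B E))"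
    using runs_emit_names[OF _ _ regs, where k = 4 and pre = pre and suf = suf and
        xs = "[sign_tmpl True, sign_tmpl False]" and ys = "lit_ands c i (s, v)"]
    by (simp add: words_update del: emit_name.simps fun_upd_apply)
  have 3: "runs (seqs (map (emit_edge 5)
        [(root_tmpl, var_tmpl), (var_tmpl, sign_tmpl True), (var_tmpl, sign_tmpl False),
         (sign_tmpl True, leaf_tmpl True), (sign_tmpl False, leaf_tmpl False),
         (clause_tmpl, leaf_tmpl s)]))
      (conf pre suf (words c i v ?A ?B E)) (6 * (8 * L + 20)) (conf pre suf (words c i v ?A ?B ?E))"
    using runs_emit_edges[OF _ _ regs, where k = 5 and pre = pre and suf = suf and
        xs = "[(root_tmpl, var_tmpl), (var_tmpl, sign_tmpl True), (var_tmpl, sign_tmpl False),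
         (sign_tmpl True, leaf_tmpl True), (sign_tmpl False, leaf_tmpl False),
         (clause_tmpl, leaf_tmpl s)]" and ys = "lit_edges c i (s, v)"]
    by (simp add: words_update del: emit_edge.simps fun_upd_apply)
  have 4: "runs (clear (Suc 2)) (conf pre suf (words c i v ?A ?B ?E)) (2 * length v + 3)
      (conf pre suf (words c i [] ?A ?B ?E))"
    using clear_conf[of 2 pre suf "words c i v ?A ?B ?E"]
    unfolding words_update words_simps length_map by simp
  have 5: "runs (emit (Suc 1) [Bit True]) (conf pre suf (words c i [] ?A ?B ?E)) (length [Bit True])
      (conf pre suf (words c (Suc i) [] ?A ?B ?E))"
    using emit_conf[of 1 "[Bit True]" pre suf "words c i [] ?A ?B ?E"]
    unfolding One_nat_def words_simps unfolding One_nat_def[symmetric] words_update by simp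
  show ?thesis
    unfolding write_lit_def
    by (rule runs_mono[OF runs_Cons[OF 1 runs_Cons[OF 2 runs_Cons[OF 3 runs_Cons[OF 4
          runs_Cons[OF 5 runs_Nil]]]]]]) (use assms(3) in simp)
qed

lemma runs_read_name:
  "runs read_name (conf pre (Bit s # Open # map Bit v @ Close # Close # suf) (words c i [] A B E))
    (2 * length v + 5)
    (conf (pre @ Bit s # Open # map Bit v @ [Close, Close]) suf (words c i v A B E))"
proof -
  have 1: "runs (while reads_bit (transfer 0 3))
      (conf (pre @ [Bit s, Open]) (map Bit v @ Close # Close # suf) (words c i [] A B E))
      (2 * length v + 1)
      (conf (pre @ Bit s # Open # map Bit v) (Close # Close # suf) (words c i v A B E))"
    using read_name_conf[of "pre @ [Bit s, Open]" v "Close # suf" "words c i [] A B E"]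
    by (simp add: words_update del: fun_upd_apply)
  have 2: "runs (advance 0)
      (conf (pre @ [Bit s]) (Open # map Bit v @ Close # Close # suf) (words c i [] A B E)) 1
      (conf (pre @ [Bit s, Open]) (map Bit v @ Close # Close # suf) (words c i [] A B E))"
    using advance_conf[of "pre @ [Bit s]"] by simp
  have 3: "runs (advance 0)
      (conf (pre @ Bit s # Open # map Bit v @ [Close]) (Close # suf) (words c i v A B E)) 1
      (conf (pre @ Bit s # Open # map Bit v @ [Close, Close]) suf (words c i v A B E))"
    using advance_conf[of "pre @ Bit s # Open # map Bit v @ [Close]"] by simp
  have 4: "runs (advance 0)
      (conf (pre @ Bit s # Open # map Bit v) (Close # Close # suf) (words c i v A B E)) 1
      (conf (pre @ Bit s # Open # map Bit v @ [Close]) (Close # suf) (words c i v A B E))"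
    using advance_conf[of "pre @ Bit s # Open # map Bit v"] by simp
  show ?thesis
    unfolding read_name_def
    by (rule runs_mono[OF runs_Cons[OF advance_conf runs_Cons[OF 2 runs_Cons[OF 1 runs_Cons[OF 4
          runs_Cons[OF 3 runs_Nil]]]]]]) simp
qed

lemma runs_lit:
  assumes "c \<le> L" "i \<le> L" "length (snd l) \<le> L"
  shows "runs lit (conf pre (enc_lit l @ suf) (words c i [] A B E)) (200 * (L + 1))
    (conf (pre @ enc_lit l) suf (words c (Suc i) [] (A @ enc_names (lit_ors c i l))
      (B @ enc_names (lit_ands c i l)) (E @ enc_edges (lit_edges c i l))))"
proof -
  obtain s v where l: "l = (s, v)" by fastforce
  have len: "length v \<le> L" using assms(3) by (simp add: l)
  let ?ts = "conf (pre @ [Open]) (Bit s # Open # map Bit v @ Close # Close # suf) (words c i [] A B E)"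
  let ?ts' = "conf (pre @ enc_lit l) suf (words c (Suc i) [] (A @ enc_names (lit_ors c i l))
      (B @ enc_names (lit_ands c i l)) (E @ enc_edges (lit_edges c i l)))"
  have 1: "runs (advance 0) (conf pre (enc_lit l @ suf) (words c i [] A B E)) 1 ?ts"
    using advance_conf[of pre Open] by (simp add: l enc_lit_eq)
  have "runs (seqs [read_name, write_lit s]) ?ts ((2 * length v + 5) + ((70 * L + 169) + 0)) ?ts'"
    using runs_Cons[OF runs_read_name[of "pre @ [Open]" s v suf c i A B E]
        runs_Cons[OF runs_write_lit[OF assms(1,2) len, where s = s] runs_Nil]]
    by (simp add: l enc_lit_eq del: lit_ors.simps lit_ands.simps lit_edges.simps)
  then have "runs (cond (\<lambda>xs. xs ! 0 = Some (Bit True))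
      (seqs [read_name, write_lit True]) (seqs [read_name, write_lit False])) ?ts
      (Suc ((2 * length v + 5) + ((70 * L + 169) + 0))) ?ts'"
    by (cases s; intro runs_cond_True runs_cond_False; simp only: read_input; simp)
  from runs_Cons[OF 1 runs_Cons[OF this runs_Nil]] show ?thesis
    unfolding lit_def by (rule runs_mono) (use len in simp)
qed

text \<open>Each literal is charged \<open>L + 1\<close> more than in \<open>runs_lit\<close>, which
  pays for the loop test before it; the final \<open>1\<close> is the failing test.\<close>

lemma runs_lits:
  assumes "c \<le> L" "i + length C \<le> L" "\<forall>l \<in> set C. length (snd l) \<le> L"
  shows "runs (while reads_open lit)
    (conf pre (concat (map enc_lit C) @ Close # suf) (words c i [] A B E))
    (length C * (201 * (L + 1)) + 1)
    (conf (pre @ concat (map enc_lit C)) (Close # suf)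
      (words c (i + length C) [] (A @ enc_names (clause_walk lit_ors c i C))
        (B @ enc_names (clause_walk lit_ands c i C)) (E @ enc_edges (clause_walk lit_edges c i C))))"
  using assms(2,3)
proof (induction C arbitrary: pre i A B E)
  case Nil
  have "runs (while reads_open lit) (conf pre (Close # suf) (words c i [] A B E)) (Suc 0)
      (conf pre (Close # suf) (words c i [] A B E))"
    by (rule runs_while_False) (simp add: read_input del: nth_map)
  then show ?case by simp
next
  case (Cons l C)
  let ?suf = "concat (map enc_lit C) @ Close # suf"
  let ?A = "A @ enc_names (lit_ors c i l)"
  let ?B = "B @ enc_names (lit_ands c i l)"
  let ?E = "E @ enc_edges (lit_edges c i l)"
  have 1: "runs lit (conf pre (enc_lit l @ ?suf) (words c i [] A B E)) (200 * (L + 1))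
      (conf (pre @ enc_lit l) ?suf (words c (Suc i) [] ?A ?B ?E))"
    by (rule runs_lit) (use assms(1) Cons.prems in simp_all)
  have 2: "runs (while reads_open lit) (conf (pre @ enc_lit l) ?suf (words c (Suc i) [] ?A ?B ?E))
    (length C * (201 * (L + 1)) + 1)
    (conf ((pre @ enc_lit l) @ concat (map enc_lit C)) (Close # suf)
      (words c (Suc i + length C) [] (?A @ enc_names (clause_walk lit_ors c (Suc i) C))
        (?B @ enc_names (clause_walk lit_ands c (Suc i) C))
        (?E @ enc_edges (clause_walk lit_edges c (Suc i) C))))"
    by (rule Cons.IH) (use Cons.prems in simp_all)
  have "reads_open (map read_tape (conf pre (enc_lit l @ ?suf) (words c i [] A B E)))"
    unfolding read_input by (simp add: enc_prod_def)
  from runs_while_True[OF this 1 2] have "runs (while reads_open lit)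
    (conf pre (concat (map enc_lit (l # C)) @ Close # suf) (words c i [] A B E))
    (Suc (200 * (L + 1) + (length C * (201 * (L + 1)) + 1)))
    (conf (pre @ concat (map enc_lit (l # C))) (Close # suf)
      (words c (i + length (l # C)) [] (A @ enc_names (clause_walk lit_ors c i (l # C)))
        (B @ enc_names (clause_walk lit_ands c i (l # C)))
        (E @ enc_edges (clause_walk lit_edges c i (l # C)))))"
    by simp
  then show ?case by (rule runs_mono) simp
qed

text \<open>A clause costs one unit of \<open>201 * (L + 1)\<close> per literal and one more unit,
  which covers its own node and edges, the brackets and the counter.\<close>

lemma runs_clause:
  assumes "c \<le> L" "i + length C \<le> L" "\<forall>l \<in> set C. length (snd l) \<le> L"
  shows "runs clause (conf pre (enc_clause C @ suf) (words c i [] A B E))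
    ((length C + 1) * (201 * (L + 1)))
    (conf (pre @ enc_clause C) suf (words (Suc c) (i + length C) []
      (A @ enc_names ([clause_node c] @ clause_walk lit_ors c i C))
      (B @ enc_names (clause_walk lit_ands c i C))
      (E @ enc_edges (clause_edges c @ clause_walk lit_edges c i C))))"
proof -
  let ?suf = "concat (map enc_lit C) @ Close # suf"
  let ?A = "A @ enc_names [clause_node c]"
  let ?E = "E @ enc_edges (clause_edges c)"
  let ?A' = "?A @ enc_names (clause_walk lit_ors c i C)"
  let ?B' = "B @ enc_names (clause_walk lit_ands c i C)"
  let ?E' = "?E @ enc_edges (clause_walk lit_edges c i C)"
  let ?w = "words c (i + length C) [] ?A' ?B' ?E'"
  have regs: "regs (contents c i []) L (words c i [] A' B' E')" for A' B' E'
    by (rule regs_words) (use assms in simp_all)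
  have 1: "runs (advance 0) (conf pre (enc_clause C @ suf) (words c i [] A B E)) 1
      (conf (pre @ [Open]) ?suf (words c i [] A B E))"
    using advance_conf[of pre Open] by (simp add: enc_list_def)
  have 2: "runs (seqs (map (emit_name 3) [clause_tmpl])) (conf (pre @ [Open]) ?suf (words c i [] A B E))
      (4 * L + 9) (conf (pre @ [Open]) ?suf (words c i [] ?A B E))"
    using runs_emit_names[OF _ _ regs, where k = 3 and pre = "pre @ [Open]" and suf = ?suf and
        xs = "[clause_tmpl]" and ys = "[clause_node c]"]
    by (simp add: words_update del: emit_name.simps fun_upd_apply)
  have 3: "runs (seqs (map (emit_edge 5) [(root_tmpl, clause_tmpl), (clause_tmpl, bot_tmpl)]))
      (conf (pre @ [Open]) ?suf (words c i [] ?A B E))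
      (2 * (8 * L + 20)) (conf (pre @ [Open]) ?suf (words c i [] ?A B ?E))"
    using runs_emit_edges[OF _ _ regs, where k = 5 and pre = "pre @ [Open]" and suf = ?suf and
        xs = "[(root_tmpl, clause_tmpl), (clause_tmpl, bot_tmpl)]" and ys = "clause_edges c"]
    by (simp add: clause_edges_def words_update del: emit_edge.simps fun_upd_apply)
  have 4: "runs (while reads_open lit) (conf (pre @ [Open]) ?suf (words c i [] ?A B ?E))
      (length C * (201 * (L + 1)) + 1)
      (conf ((pre @ [Open]) @ concat (map enc_lit C)) (Close # suf) ?w)"
    by (rule runs_lits[OF assms])
  have 5: "runs (advance 0) (conf ((pre @ [Open]) @ concat (map enc_lit C)) (Close # suf) ?w) 1
      (conf (pre @ enc_clause C) suf ?w)"
    using advance_conf[of "(pre @ [Open]) @ concat (map enc_lit C)" Close] by (simp add: enc_list_def)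
  have 6: "runs (emit (Suc 0) [Bit True]) (conf (pre @ enc_clause C) suf ?w) (length [Bit True])
      (conf (pre @ enc_clause C) suf (words (Suc c) (i + length C) [] ?A' ?B' ?E'))"
    using emit_conf[of 0 "[Bit True]" "pre @ enc_clause C" suf ?w]
    unfolding words_simps words_update by simp
  have "runs clause (conf pre (enc_clause C @ suf) (words c i [] A B E))
      ((length C + 1) * (201 * (L + 1)))
      (conf (pre @ enc_clause C) suf (words (Suc c) (i + length C) [] ?A' ?B' ?E'))"
    unfolding clause_def
    by (rule runs_mono[OF runs_Cons[OF 1 runs_Cons[OF 2 runs_Cons[OF 3 runs_Cons[OF 4
          runs_Cons[OF 5 runs_Cons[OF 6 runs_Nil]]]]]]]) simp
  then show ?thesis by simp
qed

lemma runs_clauses: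
  assumes "c + length \<phi> \<le> L" "i + length (concat \<phi>) \<le> L"
    "\<forall>C \<in> set \<phi>. \<forall>l \<in> set C. length (snd l) \<le> L"
  shows "runs (while reads_open clause)
    (conf pre (concat (map enc_clause \<phi>) @ Close # suf) (words c i [] A B E))
    ((length (concat \<phi>) + length \<phi>) * (202 * (L + 1)) + 1)
    (conf (pre @ concat (map enc_clause \<phi>)) (Close # suf)
      (words (c + length \<phi>) (i + length (concat \<phi>)) []
        (A @ enc_names (walk (\<lambda>c. [clause_node c]) lit_ors c i \<phi>))
        (B @ enc_names (walk (\<lambda>c. []) lit_ands c i \<phi>))
        (E @ enc_edges (walk clause_edges lit_edges c i \<phi>))))"
  using assms
proof (induction \<phi> arbitrary: pre c i A B E)
  case Nil
  have "runs (while reads_open clause) (conf pre (Close # suf) (words c i [] A B E)) (Suc 0)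
      (conf pre (Close # suf) (words c i [] A B E))"
    by (rule runs_while_False) (simp add: read_input del: nth_map)
  then show ?case by simp
next
  case (Cons C \<phi>)
  let ?suf = "concat (map enc_clause \<phi>) @ Close # suf"
  let ?A = "A @ enc_names ([clause_node c] @ clause_walk lit_ors c i C)"
  let ?B = "B @ enc_names (clause_walk lit_ands c i C)"
  let ?E = "E @ enc_edges (clause_edges c @ clause_walk lit_edges c i C)"
  let ?i = "i + length C"
  have 1: "runs clause (conf pre (enc_clause C @ ?suf) (words c i [] A B E))
      ((length C + 1) * (201 * (L + 1)))
      (conf (pre @ enc_clause C) ?suf (words (Suc c) ?i [] ?A ?B ?E))"
    by (rule runs_clause) (use Cons.prems in simp_all)
  have 2: "runs (while reads_open clause) (conf (pre @ enc_clause C) ?suf (words (Suc c) ?i [] ?A ?B ?E))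
    ((length (concat \<phi>) + length \<phi>) * (202 * (L + 1)) + 1)
    (conf ((pre @ enc_clause C) @ concat (map enc_clause \<phi>)) (Close # suf)
      (words (Suc c + length \<phi>) (?i + length (concat \<phi>)) []
        (?A @ enc_names (walk (\<lambda>c. [clause_node c]) lit_ors (Suc c) ?i \<phi>))
        (?B @ enc_names (walk (\<lambda>c. []) lit_ands (Suc c) ?i \<phi>))
        (?E @ enc_edges (walk clause_edges lit_edges (Suc c) ?i \<phi>))))"
    by (rule Cons.IH) (use Cons.prems in simp_all)
  have "reads_open (map read_tape (conf pre (enc_clause C @ ?suf) (words c i [] A B E)))"
    unfolding read_input by (simp add: enc_list_def)
  from runs_while_True[OF this 1 2] have "runs (while reads_open clause)
    (conf pre (concat (map enc_clause (C # \<phi>)) @ Close # suf) (words c i [] A B E))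
    (Suc ((length C + 1) * (201 * (L + 1)) +
      ((length (concat \<phi>) + length \<phi>) * (202 * (L + 1)) + 1)))
    (conf (pre @ concat (map enc_clause (C # \<phi>))) (Close # suf)
      (words (c + length (C # \<phi>)) (i + length (concat (C # \<phi>))) []
        (A @ enc_names (walk (\<lambda>c. [clause_node c]) lit_ors c i (C # \<phi>)))
        (B @ enc_names (walk (\<lambda>c. []) lit_ands c i (C # \<phi>)))
        (E @ enc_edges (walk clause_edges lit_edges c i (C # \<phi>)))))"
    by (simp add: add.assoc)
  \<comment> \<open>The loop test is absorbed by raising the unit from \<open>201 * (L + 1)\<close>
    to \<open>202 * (L + 1)\<close>.\<close>
  moreover have "Suc ((length C + 1) * (201 * (L + 1))) \<le>
      (length C + 1) * (201 * (L + 1)) + (length C + 1) * (L + 1)"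
    by simp
  then have "Suc ((length C + 1) * (201 * (L + 1))) \<le> (length C + 1) * (202 * (L + 1))"
    by (simp add: algebra_simps)
  then have "Suc ((length C + 1) * (201 * (L + 1)) +
      ((length (concat \<phi>) + length \<phi>) * (202 * (L + 1)) + 1)) \<le>
      (length (concat (C # \<phi>)) + length (C # \<phi>)) * (202 * (L + 1)) + 1"
    by (simp add: algebra_simps)
  ultimately show ?case by (rule runs_mono)
qed

section \<open>The complete machine and its polynomial time bound\<close>

definition collect :: tm where
  "collect = seqs
     [emit (Suc 3) (enc_names [top_node, bot_node, guard_node]), emit (Suc 4) (enc_names [root_node]),
      emit (Suc 5) (enc_edges [(root_node, guard_node), (guard_node, top_node), (guard_node, bot_node)]),
      advance 0, while reads_open clause]"

lemma wf8_collect: "wf8 collect"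
  unfolding collect_def
  by (rule wf8_seqs) (auto simp: wf8_emit wf8_advance wf8_while wf8_clause)

lemma length_le_concat: "x \<in> set xs \<Longrightarrow> length (e x) \<le> length (concat (map e xs))"
  by (induction xs) auto

lemma enc_cnf_eq: "enc_cnf \<phi> = Open # concat (map enc_clause \<phi>) @ [Close]"
  by (simp add: enc_cnf_def enc_list_def)

lemma length_enc_lits: "length C \<le> length (concat (map enc_lit C))"
  by (induction C) (simp_all add: enc_prod_def)

lemma length_enc_cnf: "length (concat \<phi>) + length \<phi> \<le> length (enc_cnf \<phi>)"
proof -
  have "length (concat \<phi>) + length \<phi> \<le> length (concat (map enc_clause \<phi>))"
  proof (induction \<phi>)
    case (Cons C \<phi>)
    have "length C + 1 \<le> length (enc_clause C)"
      using length_enc_lits[of C] by (simp add: enc_list_def)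
    with Cons show ?case by simp
  qed simp
  then show ?thesis by (simp add: enc_cnf_eq)
qed

lemma length_var_enc_cnf:
  assumes "C \<in> set \<phi>" "l \<in> set C"
  shows "length (snd l) \<le> length (enc_cnf \<phi>)"
proof -
  have "length (snd l) \<le> length (enc_lit l)"
    by (cases l) (simp add: enc_lit_eq)
  also have "\<dots> \<le> length (concat (map enc_lit C))"
    by (rule length_le_concat[OF assms(2)])
  also have "\<dots> \<le> length (enc_clause C)"
    by (simp add: enc_list_def)
  also have "\<dots> \<le> length (concat (map enc_clause \<phi>))"
    by (rule length_le_concat[OF assms(1)])
  finally show ?thesis by (simp add: enc_cnf_eq)
qed

definition collected :: "cnf \<Rightarrow> nat \<Rightarrow> sym list" where
  "collected \<phi> = words (length \<phi>) (length (concat \<phi>)) []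
     (enc_names (or_list \<phi>)) (enc_names (and_list \<phi>)) (enc_edges (edge_list \<phi>))"

lemma runs_collect:
  fixes \<phi> :: cnf
  defines "N \<equiv> length (enc_cnf \<phi>)"
  shows "\<exists>pre suf. runs collect (conf [] (enc_cnf \<phi>) (\<lambda>_. [])) (N * (202 * (N + 1)) + 40)
    (conf pre suf (collected \<phi>))"
proof -
  let ?suf = "concat (map enc_clause \<phi>) @ Close # []"
  let ?A = "enc_names [top_node, bot_node, guard_node]"
  let ?B = "enc_names [root_node]"
  let ?E = "enc_edges [(root_node, guard_node), (guard_node, top_node), (guard_node, bot_node)]"
  have init: "(\<lambda>_. []) = words 0 0 [] [] [] []"
    by (simp add: words_def fun_eq_iff)
  have 1: "runs (emit (Suc 3) ?A) (conf [] (enc_cnf \<phi>) (words 0 0 [] [] [] [])) (length ?A)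
      (conf [] (enc_cnf \<phi>) (words 0 0 [] ?A [] []))"
    using emit_conf[of 3 ?A "[]" "enc_cnf \<phi>" "words 0 0 [] [] [] []"]
    unfolding words_simps words_update append_Nil by simp
  have 2: "runs (emit (Suc 4) ?B) (conf [] (enc_cnf \<phi>) (words 0 0 [] ?A [] [])) (length ?B)
      (conf [] (enc_cnf \<phi>) (words 0 0 [] ?A ?B []))"
    using emit_conf[of 4 ?B "[]" "enc_cnf \<phi>" "words 0 0 [] ?A [] []"]
    unfolding words_simps words_update append_Nil by simp
  have 3: "runs (emit (Suc 5) ?E) (conf [] (enc_cnf \<phi>) (words 0 0 [] ?A ?B [])) (length ?E)
      (conf [] (enc_cnf \<phi>) (words 0 0 [] ?A ?B ?E))"
    using emit_conf[of 5 ?E "[]" "enc_cnf \<phi>" "words 0 0 [] ?A ?B []"]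
    unfolding words_simps words_update append_Nil by simp
  have 4: "runs (advance 0) (conf [] (enc_cnf \<phi>) (words 0 0 [] ?A ?B ?E)) 1
      (conf [Open] ?suf (words 0 0 [] ?A ?B ?E))"
    using advance_conf[of "[]" Open ?suf] by (simp add: enc_cnf_eq)
  \<comment> \<open>The input length \<open>N\<close> serves as \<open>L\<close>: it bounds the
    number of clauses, the number of literals and the length of every variable name.\<close>
  have 5: "runs (while reads_open clause) (conf [Open] ?suf (words 0 0 [] ?A ?B ?E))
    ((length (concat \<phi>) + length \<phi>) * (202 * (N + 1)) + 1)
    (conf ([Open] @ concat (map enc_clause \<phi>)) [Close] (words (0 + length \<phi>) (0 + length (concat \<phi>)) []
        (?A @ enc_names (walk (\<lambda>c. [clause_node c]) lit_ors 0 0 \<phi>))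
        (?B @ enc_names (walk (\<lambda>c. []) lit_ands 0 0 \<phi>))
        (?E @ enc_edges (walk clause_edges lit_edges 0 0 \<phi>))))"
    by (rule runs_clauses)
      (use length_enc_cnf[of \<phi>] length_var_enc_cnf[of _ \<phi>] in \<open>auto simp: N_def\<close>)
  have "runs collect (conf [] (enc_cnf \<phi>) (\<lambda>_. []))
      (length ?A + (length ?B + (length ?E + (1 +
        (((length (concat \<phi>) + length \<phi>) * (202 * (N + 1)) + 1) + 0)))))
      (conf ([Open] @ concat (map enc_clause \<phi>)) [Close] (collected \<phi>))"
    unfolding init collect_def
    using runs_Cons[OF 1 runs_Cons[OF 2 runs_Cons[OF 3 runs_Cons[OF 4 runs_Cons[OF 5 runs_Nil]]]]]
    by (simp only: collected_def or_list_def and_list_def edge_list_def map_append concat_append add_0)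
  moreover have "(length (concat \<phi>) + length \<phi>) * (202 * (N + 1)) \<le> N * (202 * (N + 1))"
    unfolding N_def by (rule mult_le_mono1) (rule length_enc_cnf)
  \<comment> \<open>The fixed words have 10, 2 and 26 symbols; the first move and the last loop test
    complete the 40.\<close>
  then have "length ?A + (length ?B + (length ?E + (1 +
      (((length (concat \<phi>) + length \<phi>) * (202 * (N + 1)) + 1) + 0)))) \<le> N * (202 * (N + 1)) + 40"
    by (simp add: enc_name_eq enc_prod_def)
  ultimately show ?thesis by (blast intro: runs_mono)
qed

text \<open>The words \<open>a\<close> and \<open>b\<close> are printed as the OR and the AND nodes,
  so swapping them gives the dual graph. The five \<open>Close\<close> symbols end the five nested
  pairs of the listing, and the unary occurrence counter is itself the body of
  \<open>enc_nat\<close> for the threshold.\<close>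

definition finish :: "nat \<Rightarrow> nat \<Rightarrow> name \<Rightarrow> name \<Rightarrow> tm" where
  "finish a b x y = seqs
     [emit (Suc 6) [Open, Open, Open], copy (Suc a) (Suc 6),
      emit (Suc 6) [Close, Open, Open], copy (Suc b) (Suc 6),
      emit (Suc 6) [Close, Open, Open], copy (Suc 5) (Suc 6),
      emit (Suc 6) ([Close, Open] @ enc_list enc_name [x] @ [Open] @ enc_list enc_name [y] @
        enc_name root_node @ replicate 5 Close @ [Open]), copy (Suc 1) (Suc 6),
      emit (Suc 6) [Close, Close]]"

lemma wf8_finish: "wf8 (finish a b x y)"
  unfolding finish_def by (rule wf8_seqs) (auto simp: wf8_emit wf8_copy)

lemma emit_out:
  "runs (emit (Suc 6) w) (conf pre suf (ws(6 := u))) (length w) (conf pre suf (ws(6 := u @ w)))"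
  using emit_conf[of 6 w pre suf "ws(6 := u)"] by simp

lemma copy_out:
  assumes "j < 6"
  shows "runs (copy (Suc j) (Suc 6)) (conf pre suf (ws(6 := u))) (4 * length (ws j) + 4)
    (conf pre suf (ws(6 := u @ ws j)))"
  using copy_conf[of j 6 pre suf "ws(6 := u)"] assms by simp

text \<open>Four copies take \<open>4 * t + 4\<close> each, and the constant pieces have at most 3 +
  3 + 3 + 21 + 2 symbols.\<close>

lemma runs_finish:
  assumes "a < 6" "b < 6" "ws a = enc_names P" "ws b = enc_names Q" "ws 5 = enc_edges es"
    "ws 1 = map Bit (replicate k True)" "ws 6 = []"
    "length (ws a) \<le> t" "length (ws b) \<le> t" "length (ws 5) \<le> t" "length (ws 1) \<le> t"
    "length x \<le> 1" "length y \<le> 1"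
  shows "runs (finish a b x y) (conf pre suf ws) (16 * t + 48)
    (conf pre suf (ws(6 := enc_prod enc_graph enc_nat ((P, Q, es, [x], [y], root_node), k))))"
proof -
  have "ws = ws(6 := [])" using assms(7) by auto
  let ?mid = "[Close, Open] @ enc_list enc_name [x] @ [Open] @ enc_list enc_name [y] @
    enc_name root_node @ replicate 5 Close @ [Open]"
  let ?out = "(((((((([] @ [Open, Open, Open]) @ ws a) @ [Close, Open, Open]) @ ws b) @
    [Close, Open, Open]) @ ws 5) @ ?mid) @ ws 1) @ [Close, Close]"
  have five: "(5 :: nat) < 6" and one: "(1 :: nat) < 6" by simp_all
  have "runs (finish a b x y) (conf pre suf (ws(6 := [])))
      (length [Open, Open, Open] + ((4 * length (ws a) + 4) + (length [Close, Open, Open] +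
        ((4 * length (ws b) + 4) + (length [Close, Open, Open] + ((4 * length (ws 5) + 4) +
          (length ?mid + ((4 * length (ws 1) + 4) + (length [Close, Close] + 0)))))))))
      (conf pre suf (ws(6 := ?out)))"
    unfolding finish_def
    by (rule runs_Cons runs_Nil emit_out copy_out assms(1,2) five one)+
  moreover have "?out = enc_prod enc_graph enc_nat ((P, Q, es, [x], [y], root_node), k)"
    unfolding assms(3-6)
    by (simp add: enc_graph_def enc_nat_def enc_prod_def enc_list_def[of enc_name]
        enc_list_def[of "enc_prod _ _"] enc_name_eq numeral_eq_Suc)
  moreover have "length ?mid \<le> 21"
    using assms(12,13) by (simp add: enc_name_eq enc_list_def[of enc_name])
  ultimately show ?thesis
    using assms(8-11) \<open>ws = ws(6 := [])\<close> by (auto elim!: runs_mono simp del: append_assoc)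
qed

lemma poly_time_reduction:
  fixes a b :: nat
  assumes "(a = 3 \<and> P = or_list \<or> a = 4 \<and> P = and_list)"
    "(b = 3 \<and> Q = or_list \<or> b = 4 \<and> Q = and_list)" "length x \<le> 1" "length y \<le> 1"
  shows "poly_time enc_cnf (enc_prod enc_graph enc_nat)
    (\<lambda>\<phi>. ((P \<phi>, Q \<phi>, edge_list \<phi>, [x], [y], root_node), length (concat \<phi>)))"
proof -
  define M where "M = seq collect (finish a b x y)"
  \<comment> \<open>The total time is \<open>17 * t + 48\<close> with
    \<open>t = 202 * N * (N + 1) + 40\<close>, multiplied out.\<close>
  define p :: "nat poly" where "p = [:728, 3434, 3434:]"
  have wf: "wf8 M" unfolding M_def by (intro wf8_seq wf8_collect wf8_finish)
  have "computes_in M (enc_cnf \<phi>) (poly p (length (enc_cnf \<phi>)))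
    (enc_prod enc_graph enc_nat ((P \<phi>, Q \<phi>, edge_list \<phi>, [x], [y], root_node), length (concat \<phi>)))"
    for \<phi>
  proof -
    define N where "N = length (enc_cnf \<phi>)"
    define t where "t = N * (202 * (N + 1)) + 40"
    let ?ts = "conf [] (enc_cnf \<phi>) (\<lambda>_. [])"
    let ?out = "enc_prod enc_graph enc_nat
      ((P \<phi>, Q \<phi>, edge_list \<phi>, [x], [y], root_node), length (concat \<phi>))"
    obtain pre suf where run: "runs collect ?ts t (conf pre suf (collected \<phi>))"
      unfolding t_def N_def using runs_collect by blast
    \<comment> \<open>All heads start at cell \<open>0\<close> and end just behind their words, so
      \<open>runs_head_bound\<close> bounds the lengths.\<close>
    have len: "length (collected \<phi> k) \<le> t" if "k < 7" for k
      using runs_head_bound[OF run, of "Suc k"] that by (simp add: tape_end_def)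
    have "runs (finish a b x y) (conf pre suf (collected \<phi>)) (16 * t + 48)
        (conf pre suf ((collected \<phi>)(6 := ?out)))"
      by (rule runs_finish)
        (use assms len[of 1] len[of 3] len[of 4] len[of 5] in \<open>auto simp: collected_def\<close>)
    with run have "runs M ?ts (t + (16 * t + 48)) (conf pre suf ((collected \<phi>)(6 := ?out)))"
      unfolding M_def by (rule runs_seq)
    moreover have "t + (16 * t + 48) = poly p N"
      by (simp add: t_def p_def algebra_simps)
    moreover have "init_config M (enc_cnf \<phi>) = (0, ?ts)"
      using wf by (simp add: wf8_def init_config_def conf_def tape_end_def map_replicate_const)
    moreover have "fst (last (conf pre suf ((collected \<phi>)(6 := ?out)))) = word_cells ?out"
      by (simp add: conf_def last_map tape_end_def)
    ultimately show ?thesis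
      by (simp add: computes_in_def runs_def N_def)
  qed
  with wf show ?thesis unfolding poly_time_def wf8_def by blast
qed

theorem theorem1:
  shows "sat_reduces_to_finding proof_number \<and> sat_reduces_to_finding disproof_number"
proof
  let ?k = "\<lambda>\<phi> :: cnf. length (concat \<phi>)"
  have "poly_time enc_cnf (enc_prod enc_graph enc_nat) (\<lambda>\<phi>. (cnf_graph \<phi>, ?k \<phi>))"
    unfolding cnf_graph_def by (rule poly_time_reduction[of 3 _ 4]) simp_all
  moreover have "root_of (cnf_graph \<phi>) = root_node" for \<phi>
    by (simp add: cnf_graph_def)
  ultimately show "sat_reduces_to_finding proof_number"
    unfolding sat_reduces_to_finding_def
    by (intro exI[of _ cnf_graph] exI[of _ ?k])
      (simp add: and_or_dag_G is_root_G proof_number_G)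
next
  let ?k = "\<lambda>\<phi> :: cnf. length (concat \<phi>)"
  have "poly_time enc_cnf (enc_prod enc_graph enc_nat) (\<lambda>\<phi>. (dual_cnf_graph \<phi>, ?k \<phi>))"
    \<comment> \<open>The same machine scheme with the two node lists exchanged.\<close>
    unfolding dual_cnf_graph_def by (rule poly_time_reduction[of 4 _ 3]) simp_all
  moreover have "root_of (dual_cnf_graph \<phi>) = root_node" for \<phi>
    by (simp add: dual_cnf_graph_def)
  ultimately show "sat_reduces_to_finding disproof_number"
    unfolding sat_reduces_to_finding_def
    by (intro exI[of _ dual_cnf_graph] exI[of _ ?k])
      (simp add: dual_cnf_graph and_or_dag_dual is_root_dual disproof_number_dual
        and_or_dag_G is_root_G proof_number_G)
qed

end
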